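(* Consider the Gaussian random many-access channel with $\ell_n$ users at blocklength $n$, each active independently with probability $\alpha_n$, where $\alpha_n\to\alpha\in[0,1]$ as $n\to\infty$, with average number of active users $k_n=\alpha_n\ell_n$ and noise variance $N_0/2$ per channel use. Assume that $k_n=\Omega(1)$. The largest rate per unit-energy $\dot{C}_{\bot}$ achievable with an orthogonal-access scheme satisfies the following: 1) If $\ell_n=o(n/\log n)$, then $\dot{C}_{\bot}=\frac{\log e}{N_0}$. 2) If $\ell_n=\omega(n/\log n)$, then $\dot{C}_{\bot}=0$.
   Context: Model. Let $N_0>0$. For each blocklength $n$ there are $\ell_n$ users with mutually independent messages $W_1,\dots,W_{\ell_n}$. User $i$'s message takes values in $\{0,1,\dots,M_n\}$ with $\Pr\{W_i=0\}=1-\alpha_n$ (user inactive) and $\Pr\{W_i=w\}=\alpha_n/M_n$ for $w\in\{1,\dots,M_n\}$. The received vector is $\mathbf{Y}=\sum_{i=1}^{\ell_n}\mathbf{X}_i(W_i)+\mathbf{Z}\in\mathbb{R}^n$, where $\mathbf{X}_i(W_i)\in\mathbb{R}^n$ is user $i$'s codeword and $\mathbf{Z}$ has i.i.d. $\mathcal{N}(0,N_0/2)$ components, independent of the messages. Codes. A (symmetric) $(n,M_n,E_n,\epsilon)$ code, $0\le\epsilon<1$, consists of encoding functions $f_i:\{0,1,\dots,M_n\}\to\mathbb{R}^n$, $i=1,\dots,\ell_n$, mapping $W_i$ to $\mathbf{X}_i(W_i)$, with $f_i(0)=\mathbf{0}$ and $\|f_i(w)\|^2\le E_n$ for all $w$,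 and a decoding function $g:\mathbb{R}^n\to\{0,1,\dots,M_n\}^{\ell_n}$ such that $P_e^{(n)}=\Pr\{g(\mathbf{Y})\ne(W_1,\dots,W_{\ell_n})\}\le\epsilon$. Only symmetric codes (same $M_n$ and $E_n$ for all users) are considered. Orthogonal access. An orthogonal-access scheme is one in which the codewords of different users are orthogonal to each other: $\langle f_i(w),f_j(w')\rangle=0$ for all $i\ne j$ and all messages $w,w'$ (for instance, each user is assigned its own set of channel uses, disjoint from those of the other users, possibly of different sizes for different users). Rates. A rate per unit-energy $\dot{R}$ is $\epsilon$-achievable with an orthogonal-access scheme if for every $\delta>0$ there is $n_0$ such that for every $n\ge n_0$ there is an $(n,M_n,E_n,\epsilon)$ code that is an orthogonal-access scheme and satisfies $\frac{\log M_n}{E_n}>\dot{R}-\delta$. It is achievable with an orthogonal-access scheme if this holds for all $0<\epsilon<1$. $\dot{C}_{\bot}$ is the supremum of all rates per unit-energy achievable with an orthogonal-access scheme. All logarithms $\log$ are to the same fixed base. Order notation for nonnegative sequences: $a_n=o(b_n)$ means $a_n/b_n\to0$; $a_n=\omega(b_n)$ means $a_n/b_n\to\infty$; $a_n=\Omega(b_n)$ means $\liminf_{n\to\infty} a_n/b_n>0$. *)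

theory Defs
  imports "HOL-Probability.Probability" "HOL-Library.Landau_Symbols"
begin

text \<open>
  The blocklength \<open>n\<close> varies inside the definitions of rate and capacity, so a vector of
  \<open>\<real>\<^sup>n\<close> is a function \<open>nat \<Rightarrow> real\<close> of which only the coordinates below \<open>n\<close> matter, and
  users are numbered \<open>0, \<dots>, l - 1\<close>.  A family of encoders is a function \<open>f\<close> with
  \<open>f i w k\<close> the \<open>k\<close>-th coordinate of user \<open>i\<close>'s codeword for message \<open>w\<close>.
\<close>

definition inner_n :: "nat \<Rightarrow> (nat \<Rightarrow> real) \<Rightarrow> (nat \<Rightarrow> real) \<Rightarrow> real" where
  "inner_n n x y = (\<Sum>k<n. x k * y k)"

definition message_pmf :: "nat \<Rightarrow> real \<Rightarrow> nat pmf" where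
  "message_pmf M \<alpha> =
     bind_pmf (bernoulli_pmf \<alpha>) (\<lambda>active. if active then pmf_of_set {1..M} else return_pmf 0)"

lemma pmf_message_pmf:
  assumes "0 \<le> \<alpha>" "\<alpha> \<le> 1" "1 \<le> M"
  shows "pmf (message_pmf M \<alpha>) w =
           (if w = 0 then 1 - \<alpha> else if w \<le> M then \<alpha> / real M else 0)"
  using assms by (auto simp: message_pmf_def pmf_bind integral_measure_pmf[of UNIV] UNIV_bool
    indicator_def)

definition messages_pmf :: "nat \<Rightarrow> nat \<Rightarrow> real \<Rightarrow> (nat \<Rightarrow> nat) pmf" where
  "messages_pmf l M \<alpha> = Pi_pmf {..<l} undefined (\<lambda>_. message_pmf M \<alpha>)"

text \<open>The second parameter of \<^const>\<open>normal_density\<close> is the standard deviation, not the variance.\<close>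

definition noise_measure :: "nat \<Rightarrow> real \<Rightarrow> (nat \<Rightarrow> real) measure" where
  "noise_measure n N0 = (\<Pi>\<^sub>M k\<in>{..<n}. density lborel (normal_density 0 (sqrt (N0 / 2))))"

definition received ::
  "nat \<Rightarrow> nat \<Rightarrow> (nat \<Rightarrow> nat \<Rightarrow> nat \<Rightarrow> real) \<Rightarrow> (nat \<Rightarrow> nat) \<Rightarrow> (nat \<Rightarrow> real) \<Rightarrow> (nat \<Rightarrow> real)" where
  "received n l f W Z = (\<lambda>k\<in>{..<n}. (\<Sum>i<l. f i (W i) k) + Z k)"

definition error_prob ::
  "real \<Rightarrow> nat \<Rightarrow> nat \<Rightarrow> real \<Rightarrow> nat \<Rightarrow> (nat \<Rightarrow> nat \<Rightarrow> nat \<Rightarrow> real)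
    \<Rightarrow> ((nat \<Rightarrow> real) \<Rightarrow> (nat \<Rightarrow> nat)) \<Rightarrow> real" where
  "error_prob N0 n l \<alpha> M f g =
     (let P = measure_pmf (messages_pmf l M \<alpha>) \<Otimes>\<^sub>M noise_measure n N0
      in measure P {(W, Z) \<in> space P. g (received n l f W Z) \<noteq> W})"

text \<open>
  The decoder is required to be measurable, so that the error event is one; its message tuples
  are extensional on \<open>{..<l}\<close>, as are the samples of \<^const>\<open>messages_pmf\<close>.
\<close>

definition is_code ::
  "real \<Rightarrow> nat \<Rightarrow> nat \<Rightarrow> real \<Rightarrow> nat \<Rightarrow> real \<Rightarrow> real \<Rightarrow> (nat \<Rightarrow> nat \<Rightarrow> nat \<Rightarrow> real)
    \<Rightarrow> ((nat \<Rightarrow> real) \<Rightarrow> (nat \<Rightarrow> nat)) \<Rightarrow> bool" where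
  "is_code N0 n l \<alpha> M E \<epsilon> f g \<longleftrightarrow>
     1 \<le> M \<and> 0 \<le> \<epsilon> \<and> \<epsilon> < 1 \<and>
     (\<forall>i<l. \<forall>k<n. f i 0 k = 0) \<and>
     (\<forall>i<l. \<forall>w\<le>M. inner_n n (f i w) (f i w) \<le> E) \<and>
     g \<in> (\<Pi>\<^sub>M k\<in>{..<n}. borel) \<rightarrow>\<^sub>M count_space (\<Pi>\<^sub>E i\<in>{..<l}. {0..M}) \<and>
     error_prob N0 n l \<alpha> M f g \<le> \<epsilon>"

definition orthogonal_access ::
  "nat \<Rightarrow> nat \<Rightarrow> nat \<Rightarrow> (nat \<Rightarrow> nat \<Rightarrow> nat \<Rightarrow> real) \<Rightarrow> bool" where
  "orthogonal_access n l M f \<longleftrightarrow>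
     (\<forall>i<l. \<forall>j<l. i \<noteq> j \<longrightarrow> (\<forall>w\<le>M. \<forall>w'\<le>M. inner_n n (f i w) (f j w') = 0))"

definition eps_achievable_orth ::
  "real \<Rightarrow> real \<Rightarrow> (nat \<Rightarrow> nat) \<Rightarrow> (nat \<Rightarrow> real) \<Rightarrow> real \<Rightarrow> real \<Rightarrow> bool" where
  "eps_achievable_orth b N0 l \<alpha> \<epsilon> R \<longleftrightarrow>
     (\<forall>\<delta>>0. \<exists>n0. \<forall>n\<ge>n0. \<exists>M E f g.
        is_code N0 n (l n) (\<alpha> n) M E \<epsilon> f g \<and> orthogonal_access n (l n) M f \<and>
        0 < E \<and> log b (real M) / E > R - \<delta>)"

definition achievable_orth ::
  "real \<Rightarrow> real \<Rightarrow> (nat \<Rightarrow> nat) \<Rightarrow> (nat \<Rightarrow> real) \<Rightarrow> real \<Rightarrow> bool" where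
  "achievable_orth b N0 l \<alpha> R \<longleftrightarrow> (\<forall>\<epsilon>. 0 < \<epsilon> \<and> \<epsilon> < 1 \<longrightarrow> eps_achievable_orth b N0 l \<alpha> \<epsilon> R)"

text \<open>
  Rates are nonnegative, so the supremum is taken in \<^typ>\<open>ennreal\<close>.  It is \<open>\<infinity>\<close> for an
  unbounded set of rates and \<open>0\<close> when no rate is achievable.  The latter does happen: with
  \<open>l n = n\<^sup>2\<close> users, each active with probability \<open>1/2\<close>, all but \<open>n\<close> users of an
  orthogonal-access scheme have only the zero codeword, and no rate is achievable at all.
\<close>

definition C_orth :: "real \<Rightarrow> real \<Rightarrow> (nat \<Rightarrow> nat) \<Rightarrow> (nat \<Rightarrow> real) \<Rightarrow> ennreal" where
  "C_orth b N0 l \<alpha> = Sup {ennreal R | R. 0 \<le> R \<and> achievable_orth b N0 l \<alpha> R}"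

end

theory Submission
  imports Defs "HOL-Real_Asymp.Real_Asymp"
begin

text \<open>
  Notation: \<open>P\<^sub>x\<close> is the law of \<open>x + Z\<close>, \<open>\<phi> W\<close> the probability that the message tuple \<open>W\<close> is decoded
  wrongly, and \<open>W(i := w)\<close> the tuple in which the message of user \<open>i\<close> is resampled uniformly.

  Resampling: if \<open>i\<close> is uniform on a set \<open>S\<close> of users, the law of \<open>W(i := w)\<close> has density
  \<open>N / (\<alpha> |S|)\<close> with respect to that of \<open>W\<close>, where \<open>N\<close> is the number of active users in \<open>S\<close>.  Its second
  moment is bounded when \<open>k\<^sub>n = \<Omega>(1)\<close>, so a small joint error probability remains small after
  resampling, which singles out one user with \<open>M\<close> equally likely messages and reliable decoding.

  Upper bound: comparing \<open>P\<^sub>x\<close> with pure noise through Young's inequality, the decoding regions of this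
  user being disjoint, gives \<open>1 - \<epsilon>' \<le> exp ((p - 1) (E / N0 - ln M / p))\<close> for all \<open>p > 1\<close>.  As
  \<open>M \<ge> 2\<close>, a rate above capacity contradicts this for small \<open>\<epsilon>'\<close>, whether or not \<open>E\<close> is bounded.

  Zero capacity: by orthogonality the average over \<open>i\<close> of the laws of the output under \<open>W(i := w)\<close> is
  within \<open>exp (8 E / N0) / l\<close> of the law under \<open>W\<close> in \<open>\<chi>\<^sup>2\<close>-distance, so \<open>W\<close> can only be recognised if
  \<open>E \<ge> const * log l\<close>.  Half of the users have codewords in a space of dimension at most
  \<open>d = 2 n / l = o(log n)\<close>; rounding coordinates leaves only \<open>exp (c E + O(d))\<close> distinguishable
  codewords for any \<open>c > 0\<close>, hence \<open>log M = o(E)\<close>.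

  Achievability: every user owns \<open>n div l\<close> channel uses, much more than \<open>log n\<close>, and uses sign
  vectors with pairwise correlation at most \<open>\<kappa> / 2\<close>, of which there are exponentially many.  With
  \<open>E = K log n\<close>, threshold decoding errs with probability \<open>O(n\<^sup>-\<^sup>2)\<close> per user.
\<close>

subsection \<open>Gaussian noise and changes of measure\<close>

text \<open>The Radon-Nikodym derivative of the law of \<open>x + Z\<close> with respect to that of
  \<open>Z\<close>. The variance \<open>N0 / 2\<close> per coordinate is what leaves
  \<open>N0\<close> alone in the denominator.\<close>

definition likelihood :: "real \<Rightarrow> nat \<Rightarrow> (nat \<Rightarrow> real) \<Rightarrow> (nat \<Rightarrow> real) \<Rightarrow> real" where
  "likelihood N0 n x z = exp ((2 * inner_n n z x - inner_n n x x) / N0)"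

text \<open>The probability of \<open>D\<close> under the law of \<open>x + Z\<close>. Restricting
  the sum to \<open>{..<n}\<close> keeps it in the product space, whose points are
  extensional.\<close>

definition shift_prob :: "real \<Rightarrow> nat \<Rightarrow> (nat \<Rightarrow> real) \<Rightarrow> (nat \<Rightarrow> real) set \<Rightarrow> real" where
  "shift_prob N0 n x D =
     measure (noise_measure n N0) {z \<in> space (noise_measure n N0). (\<lambda>k\<in>{..<n}. x k + z k) \<in> D}"

lemma sets_noise_measure: "sets (noise_measure n N0) = sets (\<Pi>\<^sub>M k\<in>{..<n}. borel)"
  unfolding noise_measure_def by (rule sets_PiM_cong) auto

lemma space_noise_measure: "space (noise_measure n N0) = {..<n} \<rightarrow>\<^sub>E UNIV"
  by (simp add: noise_measure_def space_PiM)

lemma measurable_noise_measure: "measurable (noise_measure n N0) = measurable (\<Pi>\<^sub>M k\<in>{..<n}. borel)"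
  by (intro ext measurable_cong_sets sets_noise_measure refl)

lemma prob_space_noise_measure:
  assumes "N0 > 0" shows "prob_space (noise_measure n N0)"
  unfolding noise_measure_def using assms by (intro prob_space_PiM prob_space_normal_density) auto

text \<open>Substituting \<open>z - x\<close> for \<open>z\<close> moves the shift from the set into
  the Gaussian density; expanding the square identifies the ratio of the two densities.\<close>

lemma distr_normal_shift:
  assumes "N0 > 0" and [measurable]: "A \<in> sets borel"
  defines "N \<equiv> density lborel (normal_density 0 (sqrt (N0 / 2)))"
  shows "emeasure N {z. x + z \<in> A} = \<integral>\<^sup>+z. ennreal (exp ((2 * (z * x) - x * x) / N0)) * indicator A z \<partial>N"
proof -
  let ?f = "normal_density 0 (sqrt (N0 / 2))"
  have eq: "?f (z - x) = ?f z * exp ((2 * (z * x) - x * x) / N0)" for z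
    using assms(1) by (auto simp: normal_density_def mult_exp_exp power2_eq_square field_simps)
  have "emeasure N {z. x + z \<in> A} = \<integral>\<^sup>+z. ennreal (?f z) * indicator A (x + z) \<partial>lborel"
    unfolding N_def by (subst emeasure_density) (auto intro!: nn_integral_cong simp: indicator_def)
  also have "\<dots> = \<integral>\<^sup>+z. ennreal (?f (z - x)) * indicator A z \<partial>lborel"
    by (subst nn_integral_real_affine[where c = 1 and t = "-x"]) (auto simp: algebra_simps)
  also have "\<dots> = \<integral>\<^sup>+z. ennreal (exp ((2 * (z * x) - x * x) / N0)) * indicator A z \<partial>N"
    unfolding N_def eq
    by (subst nn_integral_density) (auto intro!: nn_integral_cong simp: ennreal_mult' algebra_simps)
  finally show ?thesis .
qed

lemma measurable_inner_n [measurable]: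
  "(\<lambda>z. inner_n n z x) \<in> borel_measurable (\<Pi>\<^sub>M k\<in>{..<n}. borel)"
  unfolding inner_n_def by measurable

lemma measurable_likelihood [measurable]:
  "likelihood N0 n x \<in> borel_measurable (\<Pi>\<^sub>M k\<in>{..<n}. borel)"
  unfolding likelihood_def[abs_def] by measurable

lemma measurable_shift [measurable]:
  "(\<lambda>z. \<lambda>k\<in>{..<n}. x k + z k) \<in> (\<Pi>\<^sub>M k\<in>{..<n}. borel) \<rightarrow>\<^sub>M (\<Pi>\<^sub>M k\<in>{..<n}. (borel :: real measure))"
  by measurable

text \<open>Finite-dimensional Cameron-Martin formula. Finite measures that agree on boxes are
  equal, and on a box both sides factor into the one-dimensional identity.\<close>

lemma distr_noise_shift:
  assumes "N0 > 0"
  shows "distr (noise_measure n N0) (\<Pi>\<^sub>M k\<in>{..<n}. borel) (\<lambda>z. \<lambda>k\<in>{..<n}. x k + z k)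
           = density (noise_measure n N0) (\<lambda>z. ennreal (likelihood N0 n x z))" (is "?L = ?R")
proof -
  let ?N = "density lborel (normal_density 0 (sqrt (N0 / 2)))"
  interpret N: prob_space ?N using assms by (intro prob_space_normal_density) auto
  interpret product_prob_space "\<lambda>_. ?N" "{..<n}" ..
  have lik: "ennreal (likelihood N0 n x z) =
      (\<Prod>k<n. ennreal (exp ((2 * (z k * x k) - x k * x k) / N0)))" for z
    by (simp add: prod_ennreal likelihood_def inner_n_def exp_sum sum_divide_distrib[symmetric]
          sum_subtractf sum_distrib_left flip: exp_sum)
  show ?thesis
  proof (rule measure_eqI_PiM_finite[where I = "{..<n}" and M = "\<lambda>_. borel"])
    show "sets ?R = sets (Pi\<^sub>M {..<n} (\<lambda>_. borel))" by (simp add: sets_noise_measure)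
  next
    fix A :: "nat \<Rightarrow> real set" assume A: "\<And>i. i \<in> {..<n} \<Longrightarrow> A i \<in> sets borel"
    have m: "Pi\<^sub>E {..<n} A \<in> sets (\<Pi>\<^sub>M k\<in>{..<n}. borel)"
      using A by (intro sets_PiM_I_finite) auto
    have "emeasure ?L (Pi\<^sub>E {..<n} A) = emeasure (noise_measure n N0)
        ((\<lambda>z. \<lambda>k\<in>{..<n}. x k + z k) -` (Pi\<^sub>E {..<n} A) \<inter> space (noise_measure n N0))"
      using m by (intro emeasure_distr) (auto simp: measurable_noise_measure)
    also have "(\<lambda>z. \<lambda>k\<in>{..<n}. x k + z k) -` (Pi\<^sub>E {..<n} A) \<inter> space (noise_measure n N0)
        = (\<Pi>\<^sub>E k\<in>{..<n}. {z. x k + z \<in> A k})"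
      unfolding space_noise_measure by (intro set_eqI) (simp add: PiE_iff conj_commute)
    also have "emeasure (noise_measure n N0) \<dots> = (\<Prod>k<n. emeasure ?N {z. x k + z \<in> A k})"
      unfolding noise_measure_def
    proof (rule emeasure_PiM)
      fix k assume "k \<in> {..<n}"
      then have [measurable]: "A k \<in> sets borel" using A by auto
      show "{z. x k + z \<in> A k} \<in> sets ?N" by simp
    qed auto
    also have "\<dots> = (\<Prod>k<n. \<integral>\<^sup>+z. ennreal (exp ((2 * (z * x k) - x k * x k) / N0)) * indicator (A k) z \<partial>?N)"
      using A by (intro prod.cong refl distr_normal_shift assms) auto
    also have "\<dots> = (\<integral>\<^sup>+z. (\<Prod>k<n. ennreal (exp ((2 * (z k * x k) - x k * x k) / N0)) * indicator (A k) (z k))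
        \<partial>noise_measure n N0)"
      unfolding noise_measure_def using A
      by (intro product_nn_integral_prod[symmetric] borel_measurable_times_ennreal
            borel_measurable_indicator) auto
    also have "\<dots> = (\<integral>\<^sup>+z. ennreal (likelihood N0 n x z) * indicator (Pi\<^sub>E {..<n} A) z \<partial>noise_measure n N0)"
    proof (rule nn_integral_cong)
      fix z assume z: "z \<in> space (noise_measure n N0)"
      have "(\<Prod>k<n. indicator (A k) (z k)) = (indicator (Pi\<^sub>E {..<n} A) z :: ennreal)"
        using z by (auto simp: indicator_def space_noise_measure PiE_iff Pi_iff)
      then show "(\<Prod>k<n. ennreal (exp ((2 * (z k * x k) - x k * x k) / N0)) * indicator (A k) (z k)) =
          ennreal (likelihood N0 n x z) * indicator (Pi\<^sub>E {..<n} A) z"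
        by (simp add: lik prod.distrib)
    qed
    also have "\<dots> = emeasure ?R (Pi\<^sub>E {..<n} A)"
      using m by (subst emeasure_density) (auto simp: measurable_noise_measure sets_noise_measure)
    finally show "emeasure ?L (Pi\<^sub>E {..<n} A) = emeasure ?R (Pi\<^sub>E {..<n} A)" .
  next
    \<comment> \<open>Uniqueness of measures asks for an exhaustion by generating sets of finite
      measure; the whole space is itself a box of mass one.\<close>
    show "range (\<lambda>_::nat. space (\<Pi>\<^sub>M k\<in>{..<n}. (borel::real measure))) \<subseteq> prod_algebra {..<n} (\<lambda>_. borel)"
      by (auto simp: space_PiM intro!: prod_algebraI_finite)
    interpret \<nu>: prob_space "noise_measure n N0" by (rule prob_space_noise_measure) fact
    interpret D: prob_space ?L by (rule \<nu>.prob_space_distr) (simp add: measurable_noise_measure)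
    show "\<And>i::nat. emeasure ?L (space (\<Pi>\<^sub>M k\<in>{..<n}. (borel::real measure))) \<noteq> \<infinity>"
      by simp
  qed simp_all
qed

text \<open>By the shift formula the integral is the total mass of a translated probability
  law.\<close>

lemma
  assumes "N0 > 0"
  shows integrable_likelihood: "integrable (noise_measure n N0) (likelihood N0 n x)"
    and integral_likelihood: "(\<integral>z. likelihood N0 n x z \<partial>noise_measure n N0) = 1"
proof -
  interpret prob_space "noise_measure n N0" by (rule prob_space_noise_measure) fact
  interpret D: prob_space "distr (noise_measure n N0) (\<Pi>\<^sub>M k\<in>{..<n}. borel) (\<lambda>z. \<lambda>k\<in>{..<n}. x k + z k)"
    by (rule prob_space_distr) (auto simp: measurable_noise_measure)
  have "(\<integral>\<^sup>+z. ennreal (likelihood N0 n x z) \<partial>noise_measure n N0)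
      = emeasure (density (noise_measure n N0) (\<lambda>z. ennreal (likelihood N0 n x z))) (space (noise_measure n N0))"
    by (subst emeasure_density) (auto simp: measurable_noise_measure intro!: nn_integral_cong)
  also have "\<dots> = 1"
    unfolding distr_noise_shift[OF assms, symmetric]
    using D.emeasure_space_1 by (simp add: space_noise_measure space_PiM)
  finally have 1: "(\<integral>\<^sup>+z. ennreal (likelihood N0 n x z) \<partial>noise_measure n N0) = 1" .
  show "integrable (noise_measure n N0) (likelihood N0 n x)"
    by (rule integrableI_nonneg) (auto simp: measurable_noise_measure 1, simp add: likelihood_def)
  show "(\<integral>z. likelihood N0 n x z \<partial>noise_measure n N0) = 1"
    by (subst integral_eq_nn_integral) (auto simp: measurable_noise_measure 1, simp add: likelihood_def)
qed

text \<open>The shift formula is applied to the preimage of \<open>D\<close> under translation by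
  \<open>m\<close>, so that laws can be compared with any centre \<open>m\<close> and not only with
  pure noise.\<close>

lemma shift_prob_add:
  assumes "N0 > 0" and D [measurable]: "D \<in> sets (\<Pi>\<^sub>M k\<in>{..<n}. borel)"
  shows "shift_prob N0 n (\<lambda>k. m k + x k) D =
    (\<integral>z. likelihood N0 n x z * indicator D (\<lambda>k\<in>{..<n}. m k + z k) \<partial>noise_measure n N0)"
proof -
  let ?\<nu> = "noise_measure n N0" and ?B = "\<Pi>\<^sub>M k\<in>{..<n}. (borel :: real measure)"
  interpret prob_space ?\<nu> by (rule prob_space_noise_measure) fact
  define D' where "D' = {z \<in> space ?B. (\<lambda>k\<in>{..<n}. m k + z k) \<in> D}"
  have D' [measurable]: "D' \<in> sets ?B" unfolding D'_def by measurable
  have sp: "space ?\<nu> = space ?B" by (simp add: space_noise_measure space_PiM)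
  have "{z \<in> space ?\<nu>. (\<lambda>k\<in>{..<n}. (m k + x k) + z k) \<in> D}
      = (\<lambda>z. \<lambda>k\<in>{..<n}. x k + z k) -` D' \<inter> space ?\<nu>"
    by (auto simp: D'_def sp space_PiM algebra_simps cong: restrict_cong)
  then have "shift_prob N0 n (\<lambda>k. m k + x k) D = measure (distr ?\<nu> ?B (\<lambda>z. \<lambda>k\<in>{..<n}. x k + z k)) D'"
    unfolding shift_prob_def by (subst measure_distr) (auto simp: measurable_noise_measure)
  also have "\<dots> = enn2real (\<integral>\<^sup>+z. ennreal (likelihood N0 n x z) * indicator D' z \<partial>?\<nu>)"
    unfolding distr_noise_shift[OF assms(1)] measure_def
    by (subst emeasure_density) (auto simp: measurable_noise_measure sets_noise_measure)
  also have "\<dots> = (\<integral>z. likelihood N0 n x z * indicator D (\<lambda>k\<in>{..<n}. m k + z k) \<partial>?\<nu>)"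
    by (subst integral_eq_nn_integral)
       (auto simp: measurable_noise_measure likelihood_def D'_def sp indicator_def
             intro!: arg_cong[where f = enn2real] nn_integral_cong)
  finally show ?thesis .
qed

section \<open>Inner products and the algebra of likelihoods\<close>

lemma inner_n_add_left: "inner_n n (\<lambda>k. x k + y k) z = inner_n n x z + inner_n n y z"
  by (simp add: inner_n_def sum.distrib distrib_right)

lemma inner_n_diff_left: "inner_n n (\<lambda>k. x k - y k) z = inner_n n x z - inner_n n y z"
  by (simp add: inner_n_def sum_subtractf left_diff_distrib)

lemma inner_n_scale_left: "inner_n n (\<lambda>k. c * x k) z = c * inner_n n x z"
  by (simp add: inner_n_def sum_distrib_left mult.assoc)

lemma inner_n_sum_left: "inner_n n (\<lambda>k. \<Sum>i\<in>I. f i k) z = (\<Sum>i\<in>I. inner_n n (f i) z)"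
  by (simp add: inner_n_def sum_distrib_right) (rule sum.swap)

lemma inner_n_commute: "inner_n n x y = inner_n n y x"
  by (simp add: inner_n_def mult.commute)

lemma inner_n_add_right: "inner_n n z (\<lambda>k. x k + y k) = inner_n n z x + inner_n n z y"
  by (simp add: inner_n_def sum.distrib distrib_left)

lemma inner_n_diff_right: "inner_n n z (\<lambda>k. x k - y k) = inner_n n z x - inner_n n z y"
  by (simp add: inner_n_def sum_subtractf right_diff_distrib)

lemma inner_n_scale_right: "inner_n n z (\<lambda>k. c * x k) = c * inner_n n z x"
  by (simp add: inner_n_def sum_distrib_left mult_ac)

lemma inner_n_sum_right: "inner_n n z (\<lambda>k. \<Sum>i\<in>I. f i k) = (\<Sum>i\<in>I. inner_n n z (f i))"
  using inner_n_sum_left[where I = I and f = f and n = n and z = z] by (simp add: inner_n_commute)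

lemmas inner_n_linear = inner_n_add_left inner_n_diff_left inner_n_scale_left inner_n_sum_left
  inner_n_add_right inner_n_diff_right inner_n_scale_right inner_n_sum_right

lemma inner_n_nonneg: "0 \<le> inner_n n x x"
  by (simp add: inner_n_def sum_nonneg)

lemma inner_n_diff_le: "inner_n n (\<lambda>k. x k - y k) (\<lambda>k. x k - y k) \<le> 2 * inner_n n x x + 2 * inner_n n y y"
proof -
  have "0 \<le> inner_n n (\<lambda>k. x k + y k) (\<lambda>k. x k + y k)" by (rule inner_n_nonneg)
  then show ?thesis by (simp add: inner_n_linear inner_n_commute[of n y x])
qed

lemma likelihood_pos: "0 < likelihood N0 n x z"
  by (simp add: likelihood_def)

text \<open>Completing the square turns the product into a multiple of another likelihood, whose
  integral is one; this gives mixed second moments exactly.\<close>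

lemma likelihood_mult:
  "likelihood N0 n x z * likelihood N0 n y z
     = exp (2 * inner_n n x y / N0) * likelihood N0 n (\<lambda>k. x k + y k) z"
  unfolding likelihood_def exp_add[symmetric]
  by (simp add: inner_n_linear inner_n_commute[of n y x] add_divide_distrib[symmetric])

text \<open>Real powers are again multiples of likelihoods, so the \<open>p\<close>-th moment is
  exactly the exponential factor.\<close>

lemma likelihood_powr:
  "likelihood N0 n x z powr p
     = exp (p * (p - 1) * inner_n n x x / N0) * likelihood N0 n (\<lambda>k. p * x k) z"
  unfolding likelihood_def exp_add[symmetric] exp_powr_real
  by (simp add: inner_n_linear algebra_simps add_divide_distrib[symmetric] diff_divide_distrib[symmetric])

lemma integral_likelihood_mult:
  assumes "N0 > 0"
  shows "integrable (noise_measure n N0) (\<lambda>z. likelihood N0 n x z * likelihood N0 n y z)"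
    and "(\<integral>z. likelihood N0 n x z * likelihood N0 n y z \<partial>noise_measure n N0) = exp (2 * inner_n n x y / N0)"
  unfolding likelihood_mult using integrable_likelihood[OF assms] integral_likelihood[OF assms]
  by auto

lemma
  assumes "N0 > 0" and D [measurable]: "D \<in> sets (\<Pi>\<^sub>M k\<in>{..<n}. borel)"
  shows integrable_shift_indicator:
      "integrable (noise_measure n N0) (\<lambda>z. indicator D (\<lambda>k\<in>{..<n}. m k + z k) :: real)"
    and shift_prob_integral:
      "shift_prob N0 n m D = (\<integral>z. indicator D (\<lambda>k\<in>{..<n}. m k + z k) \<partial>noise_measure n N0)"
    and integrable_likelihood_indicator:
      "integrable (noise_measure n N0) (\<lambda>z. likelihood N0 n x z * indicator D (\<lambda>k\<in>{..<n}. m k + z k))"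
proof -
  interpret prob_space "noise_measure n N0" by (rule prob_space_noise_measure) fact
  show "integrable (noise_measure n N0) (\<lambda>z. indicator D (\<lambda>k\<in>{..<n}. m k + z k) :: real)"
    by (rule integrable_const_bound[where B = 1]) (auto simp: measurable_noise_measure indicator_def)
  show "shift_prob N0 n m D = (\<integral>z. indicator D (\<lambda>k\<in>{..<n}. m k + z k) \<partial>noise_measure n N0)"
    using shift_prob_add[OF assms, of m "\<lambda>_. 0"] by (simp add: likelihood_def inner_n_def)
  show "integrable (noise_measure n N0) (\<lambda>z. likelihood N0 n x z * indicator D (\<lambda>k\<in>{..<n}. m k + z k))"
    by (rule Bochner_Integration.integrable_bound[OF integrable_likelihood[OF assms(1), of n x]])
       (auto simp: measurable_noise_measure indicator_def)
qed

lemma shift_prob_nonneg: "0 \<le> shift_prob N0 n x D"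
  by (simp add: shift_prob_def)

lemma shift_prob_le_1: "N0 > 0 \<Longrightarrow> shift_prob N0 n x D \<le> 1"
  unfolding shift_prob_def by (rule prob_space.prob_le_1[OF prob_space_noise_measure])

lemma shift_prob_cong: "(\<And>k. k < n \<Longrightarrow> x k = y k) \<Longrightarrow> shift_prob N0 n x D = shift_prob N0 n y D"
  unfolding shift_prob_def by (intro arg_cong[where f = "measure _"]) (auto cong: restrict_cong)

lemma sum_shift_prob_le_1:
  assumes "N0 > 0" "finite I" "disjoint_family_on D I"
    and "\<And>i. i \<in> I \<Longrightarrow> D i \<in> sets (\<Pi>\<^sub>M k\<in>{..<n}. borel)"
  shows "(\<Sum>i\<in>I. shift_prob N0 n x (D i)) \<le> 1"
proof -
  interpret prob_space "noise_measure n N0" by (rule prob_space_noise_measure) fact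
  have "(\<Sum>i\<in>I. shift_prob N0 n x (D i))
      = (\<integral>z. (\<Sum>i\<in>I. indicator (D i) (\<lambda>k\<in>{..<n}. x k + z k)) \<partial>noise_measure n N0)"
    using assms by (simp add: shift_prob_integral integrable_shift_indicator)
  also have "\<dots> \<le> (\<integral>z. 1 \<partial>noise_measure n N0)"
  proof (rule integral_mono)
    fix z
    have "(\<Sum>i\<in>I. indicator (D i) y) = (indicator (\<Union>i\<in>I. D i) y :: real)" for y
      using assms by (simp add: indicator_UN_disjoint)
    then show "(\<Sum>i\<in>I. indicator (D i) (\<lambda>k\<in>{..<n}. x k + z k)) \<le> (1::real)"
      by (simp add: indicator_def)
  qed (use assms in \<open>auto intro!: integrable_shift_indicator\<close>)
  finally show ?thesis by (simp add: prob_space)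
qed

section \<open>Comparing shifted noise laws by Young's inequality and by chi-square distance\<close>

text \<open>\<open>L\<close> is the weighted geometric mean of
  \<open>s powr (1 - p) * L powr p\<close> and \<open>s\<close> with weights \<open>1/p\<close> and
  \<open>1 - 1/p\<close>, since the powers of \<open>s\<close> cancel. The parameter
  \<open>s\<close> stays free so that the two terms can be balanced later.\<close>

lemma young_weighted:
  assumes "p > 1" "s > 0" "L > (0::real)"
  shows "L \<le> s powr (1 - p) / p * L powr p + (1 - 1/p) * s"
proof -
  have "(s powr (1-p) * L powr p) powr (1/p) * s powr (1-1/p) \<le> 1/p * (s powr (1-p) * L powr p) + (1-1/p) * s"
    using assms by (intro Youngs_inequality_0) auto
  also have "(s powr (1-p) * L powr p) powr (1/p) * s powr (1-1/p) = L"
    using assms by (simp add: powr_mult powr_powr diff_divide_distrib flip: powr_add)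
  finally show ?thesis by (simp add: mult_ac)
qed

text \<open>The pointwise Young bound for the likelihood is integrated over \<open>D\<close>. The
  first term is enlarged to the whole space, where the moment is explicit; only the second term
  keeps track of \<open>D\<close>.\<close>

lemma shift_prob_young:
  assumes "N0 > 0" and D: "D \<in> sets (\<Pi>\<^sub>M k\<in>{..<n}. borel)" and "p > 1" "s > 0"
  shows "shift_prob N0 n (\<lambda>k. m k + x k) D \<le>
    s powr (1 - p) / p * exp (p * (p - 1) * inner_n n x x / N0) + (1 - 1/p) * s * shift_prob N0 n m D"
proof -
  interpret prob_space "noise_measure n N0" by (rule prob_space_noise_measure) fact
  note int = integrable_likelihood[OF assms(1)] integrable_shift_indicator[OF assms(1) D]
    integrable_likelihood_indicator[OF assms(1) D]
  have "shift_prob N0 n (\<lambda>k. m k + x k) D \<le> 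
      (\<integral>z. s powr (1-p) / p * exp (p * (p - 1) * inner_n n x x / N0) * likelihood N0 n (\<lambda>k. p * x k) z
         + (1-1/p) * s * indicator D (\<lambda>k\<in>{..<n}. m k + z k) \<partial>noise_measure n N0)"
    unfolding shift_prob_add[OF assms(1) D]
  proof (rule integral_mono)
    fix z
    have "likelihood N0 n x z \<le> s powr (1-p) / p * likelihood N0 n x z powr p + (1-1/p) * s"
      using assms by (intro young_weighted likelihood_pos)
    moreover have "0 \<le> s powr (1-p) / p * likelihood N0 n x z powr p" using assms by simp
    ultimately show "likelihood N0 n x z * indicator D (\<lambda>k\<in>{..<n}. m k + z k)
       \<le> s powr (1-p) / p * exp (p * (p - 1) * inner_n n x x / N0) * likelihood N0 n (\<lambda>k. p * x k) z
         + (1-1/p) * s * indicator D (\<lambda>k\<in>{..<n}. m k + z k)"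
      by (simp add: likelihood_powr indicator_def mult_ac)
  qed (auto intro!: int Bochner_Integration.integrable_add integrable_mult_right)
  also have "\<dots> = s powr (1-p) / p * exp (p * (p - 1) * inner_n n x x / N0) + (1-1/p) * s * shift_prob N0 n m D"
    by (subst Bochner_Integration.integral_add)
       (auto intro!: int integrable_mult_right simp: integral_likelihood[OF assms(1)] shift_prob_integral[OF assms(1) D])
  finally show ?thesis .
qed

text \<open>The average of the likelihoods has mean one, and orthogonality bounds its variance by
  \<open>exp (2 * B / N0) / card I\<close>. The difference of probabilities is the integral of one
  minus this average over an event, hence at most the standard deviation.\<close>

lemma shift_prob_chi_square:
  assumes "N0 > 0" and D: "D \<in> sets (\<Pi>\<^sub>M k\<in>{..<n}. borel)" and I: "finite I" "I \<noteq> {}"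
    and orth: "\<And>i j. i \<in> I \<Longrightarrow> j \<in> I \<Longrightarrow> i \<noteq> j \<Longrightarrow> inner_n n (x i) (x j) = 0"
    and B: "\<And>i. i \<in> I \<Longrightarrow> inner_n n (x i) (x i) \<le> B"
  shows "shift_prob N0 n m D - (\<Sum>i\<in>I. shift_prob N0 n (\<lambda>k. m k + x i k) D) / card I
    \<le> sqrt (exp (2 * B / N0) / card I)"
proof -
  interpret prob_space "noise_measure n N0" by (rule prob_space_noise_measure) fact
  let ?\<nu> = "noise_measure n N0" and ?L = "\<lambda>i. likelihood N0 n (x i)" and ?N = "real (card I)"
  let ?J = "\<lambda>z. indicator D (\<lambda>k\<in>{..<n}. m k + z k) :: real"
  define A where "A z = (\<Sum>i\<in>I. ?L i z) / ?N" for z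
  define V where "V = exp (2 * B / N0) / ?N"
  define t where "t = sqrt V"
  have N: "?N > 0" using I by (simp add: card_gt_0_iff)
  have V: "V > 0" using N by (simp add: V_def)
  then have t: "t > 0" "t * t = V" by (auto simp: t_def)
  note int = integrable_likelihood[OF assms(1)] integrable_shift_indicator[OF assms(1) D]
    integrable_likelihood_indicator[OF assms(1) D] integral_likelihood_mult(1)[OF assms(1)]
  have A2: "A z ^ 2 = (\<Sum>i\<in>I. \<Sum>j\<in>I. ?L i z * ?L j z) / ?N^2" for z
    by (simp add: A_def power_divide power2_eq_square sum_product)
  have intA: "integrable ?\<nu> A" "integrable ?\<nu> (\<lambda>z. A z ^ 2)"
    unfolding A2 unfolding A_def
    by (intro Bochner_Integration.integrable_divide Bochner_Integration.integrable_sum int)+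
  have "(\<integral>z. A z \<partial>?\<nu>) = 1"
    unfolding A_def using N by (simp add: int integral_likelihood[OF assms(1)])
  moreover have "(\<integral>z. A z ^ 2 \<partial>?\<nu>) \<le> 1 + V"
  proof -
    have "(\<integral>z. A z ^ 2 \<partial>?\<nu>) = (\<Sum>i\<in>I. \<Sum>j\<in>I. exp (2 * inner_n n (x i) (x j) / N0)) / ?N^2"
      unfolding A2 by (simp add: int integral_likelihood_mult(2)[OF assms(1)])
    \<comment> \<open>Pairs of different indices contribute exactly \<open>exp 0 = 1\<close>; only
      the diagonal feels the energy.\<close>
    also have "\<dots> \<le> (\<Sum>i\<in>I. \<Sum>j\<in>I. 1 + (if i = j then exp (2 * B / N0) else 0)) / ?N^2"
    proof (intro divide_right_mono sum_mono)
      fix i j assume ij: "i \<in> I" "j \<in> I"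
      have "exp (2 * inner_n n (x i) (x i) / N0) \<le> exp (2 * B / N0)"
        using B[OF ij(1)] assms(1) by (auto intro!: divide_right_mono)
      then show "exp (2 * inner_n n (x i) (x j) / N0) \<le> 1 + (if i = j then exp (2 * B / N0) else 0)"
        using orth[OF ij] by (cases "i = j") (auto intro: add_increasing simp del: exp_le_cancel_iff)
    qed auto
    also have "\<dots> = (?N^2 + ?N * exp (2 * B / N0)) / ?N^2"
      using I by (simp add: sum.distrib power2_eq_square distrib_left)
    also have "\<dots> = 1 + V" using N by (simp add: V_def field_simps power2_eq_square)
    finally show ?thesis .
  qed
  ultimately have var: "(\<integral>z. (1 - A z)^2 \<partial>?\<nu>) \<le> V"
    by (simp add: power2_diff intA prob_space)
  have "shift_prob N0 n m D - (\<Sum>i\<in>I. shift_prob N0 n (\<lambda>k. m k + x i k) D) / ?N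
      = (\<integral>z. ?J z - (\<Sum>i\<in>I. ?L i z * ?J z) / ?N \<partial>?\<nu>)"
    unfolding shift_prob_add[OF assms(1) D] shift_prob_integral[OF assms(1) D, of m] by (simp add: int)
  \<comment> \<open>Cauchy-Schwarz in the form of the arithmetic-geometric mean inequality: with
    \<open>t\<close> the root of the variance bound, both halves contribute
    \<open>t / 2\<close>.\<close>
  also have "\<dots> \<le> (\<integral>z. (t + (1 - A z)^2 / t) / 2 \<partial>?\<nu>)"
  proof (rule integral_mono)
    fix z
    have "(t + (1 - A z)^2 / t) / 2 - (1 - A z) = (t - (1 - A z))^2 / (2 * t)"
      using t(1) by (simp add: field_simps power2_eq_square)
    then have "1 - A z \<le> (t + (1 - A z)^2 / t) / 2" using t(1)
      by (smt (verit) divide_nonneg_pos zero_le_power2)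
    moreover have "0 \<le> (t + (1 - A z)^2 / t) / 2" using t(1) by simp
    moreover have "?J z - (\<Sum>i\<in>I. ?L i z * ?J z) / ?N = (1 - A z) * ?J z"
      by (simp add: A_def sum_distrib_right[symmetric] left_diff_distrib)
    ultimately show "?J z - (\<Sum>i\<in>I. ?L i z * ?J z) / ?N \<le> (t + (1 - A z)^2 / t) / 2"
      by (simp add: indicator_def)
  next
    show "integrable ?\<nu> (\<lambda>z. (t + (1 - A z)\<^sup>2 / t) / 2)" by (simp add: power2_diff intA)
  qed (intro Bochner_Integration.integrable_diff Bochner_Integration.integrable_divide
        Bochner_Integration.integrable_sum int)
  also have "\<dots> = (t + (\<integral>z. (1 - A z)^2 \<partial>?\<nu>) / t) / 2"
    by (simp add: power2_diff intA prob_space)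
  also have "\<dots> \<le> (t + V / t) / 2" using var t(1) by (simp add: divide_right_mono)
  also have "\<dots> = t" using t by (simp add: field_simps)
  finally show ?thesis by (simp add: t_def V_def)
qed

subsection \<open>Random messages and resampling\<close>

abbreviation messages :: "nat \<Rightarrow> nat \<Rightarrow> (nat \<Rightarrow> nat) set" where
  "messages l M \<equiv> (\<Pi>\<^sub>E i\<in>{..<l}. {0..M})"

definition codeword :: "nat \<Rightarrow> (nat \<Rightarrow> nat \<Rightarrow> nat \<Rightarrow> real) \<Rightarrow> (nat \<Rightarrow> nat) \<Rightarrow> nat \<Rightarrow> real" where
  "codeword l f W k = (\<Sum>i<l. f i (W i) k)"

definition decoding_region :: "nat \<Rightarrow> ((nat \<Rightarrow> real) \<Rightarrow> (nat \<Rightarrow> nat)) \<Rightarrow> (nat \<Rightarrow> nat) \<Rightarrow> (nat \<Rightarrow> real) set" where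
  "decoding_region n g W = {y \<in> space (\<Pi>\<^sub>M k\<in>{..<n}. borel). g y = W}"

text \<open>The conditional probability of correct decoding given the message tuple
  \<open>W\<close>; \<open>\<phi>\<close> and \<open>?\<phi>\<close> below stand for its complement
  or for any function with values in the unit interval.\<close>

definition success_prob ::
  "real \<Rightarrow> nat \<Rightarrow> nat \<Rightarrow> (nat \<Rightarrow> nat \<Rightarrow> nat \<Rightarrow> real) \<Rightarrow> ((nat \<Rightarrow> real) \<Rightarrow> (nat \<Rightarrow> nat)) \<Rightarrow> (nat \<Rightarrow> nat) \<Rightarrow> real" where
  "success_prob N0 n l f g W = shift_prob N0 n (codeword l f W) (decoding_region n g W)"

lemma finite_messages: "finite (messages l M)"
  by (intro finite_PiE) auto

lemma set_message_pmf:
  assumes "0 \<le> \<alpha>" "\<alpha> \<le> 1" "1 \<le> M"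
  shows "set_pmf (message_pmf M \<alpha>) \<subseteq> {0..M}"
proof
  fix w assume "w \<in> set_pmf (message_pmf M \<alpha>)"
  then have "pmf (message_pmf M \<alpha>) w \<noteq> 0" by (simp add: set_pmf_eq)
  then show "w \<in> {0..M}" unfolding pmf_message_pmf[OF assms] by (auto split: if_splits)
qed

lemma set_messages_pmf:
  assumes "0 \<le> \<alpha>" "\<alpha> \<le> 1" "1 \<le> M"
  shows "set_pmf (messages_pmf l M \<alpha>) \<subseteq> messages l M"
  unfolding messages_pmf_def using set_message_pmf[OF assms]
  by (subst set_Pi_pmf) (auto simp: PiE_dflt_def PiE_iff extensional_def)

lemma expectation_messages:
  assumes "0 \<le> \<alpha>" "\<alpha> \<le> 1" "1 \<le> M"
  shows "measure_pmf.expectation (messages_pmf l M \<alpha>) h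
           = (\<Sum>W\<in>messages l M. pmf (messages_pmf l M \<alpha>) W * h W)"
  using set_messages_pmf[OF assms] 
  by (subst integral_measure_pmf_real[OF finite_messages[of l M]]) (auto simp: mult.commute)

lemma integrable_messages:
  assumes "0 \<le> \<alpha>" "\<alpha> \<le> 1" "1 \<le> M"
  shows "integrable (measure_pmf (messages_pmf l M \<alpha>)) (h :: _ \<Rightarrow> real)"
  using finite_subset[OF set_messages_pmf[OF assms] finite_messages]
  by (rule integrable_measure_pmf_finite)

lemma decoding_region_sets:
  assumes "g \<in> (\<Pi>\<^sub>M k\<in>{..<n}. borel) \<rightarrow>\<^sub>M count_space (messages l M)"
  shows "decoding_region n g W \<in> sets (\<Pi>\<^sub>M k\<in>{..<n}. borel)"
proof (cases "W \<in> messages l M")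
  case True
  have "g -` {W} \<inter> space (\<Pi>\<^sub>M k\<in>{..<n}. borel) \<in> sets (\<Pi>\<^sub>M k\<in>{..<n}. borel)"
    using True by (intro measurable_sets[OF assms]) auto
  then show ?thesis by (simp add: decoding_region_def vimage_def Int_def conj_commute)
next
  case False
  then have "decoding_region n g W = {}"
    using measurable_space[OF assms] by (auto simp: decoding_region_def)
  then show ?thesis by simp
qed

text \<open>The event of correct decoding is a finite disjoint union of rectangles, one for each
  message tuple, and the product measure factors on each of them.\<close>

lemma error_prob_eq:
  assumes "0 \<le> \<alpha>" "\<alpha> \<le> 1" "1 \<le> M" "N0 > 0"
    and g: "g \<in> (\<Pi>\<^sub>M k\<in>{..<n}. borel) \<rightarrow>\<^sub>M count_space (messages l M)"
  shows "error_prob N0 n l \<alpha> M f g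
    = measure_pmf.expectation (messages_pmf l M \<alpha>) (\<lambda>W. 1 - success_prob N0 n l f g W)"
proof -
  let ?p = "messages_pmf l M \<alpha>" and ?\<nu> = "noise_measure n N0"
  let ?B = "\<Pi>\<^sub>M k\<in>{..<n}. (borel :: real measure)"
  interpret \<nu>: prob_space ?\<nu> by (rule prob_space_noise_measure) fact
  interpret P: pair_prob_space "measure_pmf ?p" ?\<nu> ..
  define G where "G W = {z \<in> space ?\<nu>. (\<lambda>k\<in>{..<n}. codeword l f W k + z k) \<in> decoding_region n g W}" for W
  have G: "G W \<in> sets ?\<nu>" for W
  proof -
    have "(\<lambda>z. \<lambda>k\<in>{..<n}. codeword l f W k + z k) -` decoding_region n g W \<inter> space ?B \<in> sets ?B"
      by (intro measurable_sets[OF measurable_shift] decoding_region_sets[OF g])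
    moreover have "space ?B = space ?\<nu>" by (simp add: space_noise_measure space_PiM)
    ultimately show ?thesis unfolding sets_noise_measure G_def by (simp add: vimage_def Int_def conj_commute)
  qed
  have rec: "received n l f W z = (\<lambda>k\<in>{..<n}. codeword l f W k + z k)" for W z
    by (simp add: received_def codeword_def)
  have inB: "received n l f W z \<in> space ?B" for W z
    by (simp add: space_PiM rec)
  let ?C = "\<Union>W\<in>messages l M. {W} \<times> G W"
  have "{(W, Z) \<in> space (measure_pmf ?p \<Otimes>\<^sub>M ?\<nu>). g (received n l f W Z) \<noteq> W}
      = space (measure_pmf ?p \<Otimes>\<^sub>M ?\<nu>) - ?C"
  proof -
    have "(W, Z) \<in> ?C \<longleftrightarrow> Z \<in> space ?\<nu> \<and> g (received n l f W Z) = W" for W Z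
      using measurable_space[OF g inB[of W Z]] inB[of W Z]
      unfolding G_def decoding_region_def rec by (simp, metis)
    then show ?thesis unfolding space_pair_measure by (auto simp del: UN_iff)
  qed
  then have "error_prob N0 n l \<alpha> M f g = measure (measure_pmf ?p \<Otimes>\<^sub>M ?\<nu>) (space (measure_pmf ?p \<Otimes>\<^sub>M ?\<nu>) - ?C)"
    by (simp add: error_prob_def Let_def)
  also have "\<dots> = 1 - measure (measure_pmf ?p \<Otimes>\<^sub>M ?\<nu>) ?C"
    by (intro P.prob_compl sets.finite_UN finite_messages pair_measureI G) simp
  also have "measure (measure_pmf ?p \<Otimes>\<^sub>M ?\<nu>) ?C
      = (\<Sum>W\<in>messages l M. measure (measure_pmf ?p \<Otimes>\<^sub>M ?\<nu>) ({W} \<times> G W))"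
  proof (rule P.finite_measure_finite_Union[OF finite_messages])
    show "(\<lambda>W. {W} \<times> G W) ` messages l M \<subseteq> sets (measure_pmf ?p \<Otimes>\<^sub>M ?\<nu>)"
      by (intro image_subsetI pair_measureI G) simp
  qed (auto simp: disjoint_family_on_def)
  also have "\<dots> = (\<Sum>W\<in>messages l M. pmf ?p W * success_prob N0 n l f g W)"
  proof (rule sum.cong)
    fix W
    have "emeasure (measure_pmf ?p \<Otimes>\<^sub>M ?\<nu>) ({W} \<times> G W) = emeasure ?p {W} * emeasure ?\<nu> (G W)"
      by (rule \<nu>.emeasure_pair_measure_Times) (auto intro: G)
    then show "measure (measure_pmf ?p \<Otimes>\<^sub>M ?\<nu>) ({W} \<times> G W) = pmf ?p W * success_prob N0 n l f g W"
      by (simp add: measure_def enn2real_mult emeasure_pmf_single success_prob_def shift_prob_def G_def)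
  qed simp
  also have "1 - \<dots> = measure_pmf.expectation ?p (\<lambda>W. 1 - success_prob N0 n l f g W)"
    using integrable_messages[OF assms(1-3)] expectation_messages[OF assms(1-3)]
    by (subst Bochner_Integration.integral_diff) auto
  finally show ?thesis .
qed

section \<open>Resampling the message of one user\<close>

text \<open>Given that user \<open>i\<close> is active, its message is uniform on
  \<open>{1..M}\<close> and independent of the others, so resampling it amounts to conditioning on
  activity, an event of probability \<open>\<alpha>\<close>.\<close>

lemma expectation_resample:
  fixes \<phi> :: "(nat \<Rightarrow> nat) \<Rightarrow> real"
  assumes "0 \<le> \<alpha>" "\<alpha> \<le> 1" "1 \<le> M" "i < l"
  shows "\<alpha> * ((\<Sum>w=1..M. measure_pmf.expectation (messages_pmf l M \<alpha>) (\<lambda>W. \<phi> (W(i := w)))) / M)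
    = measure_pmf.expectation (messages_pmf l M \<alpha>) (\<lambda>W. \<phi> W * of_bool (W i \<noteq> 0))"
proof -
  let ?q = "message_pmf M \<alpha>"
  let ?p' = "Pi_pmf ({..<l} - {i}) undefined (\<lambda>_. ?q)"
  have fin: "finite (set_pmf ?p')"
    by (rule finite_subset[OF set_Pi_pmf_subset'])
       (auto intro!: finite_PiE_dflt finite_subset[OF set_message_pmf[OF assms(1-3)]])
  \<comment> \<open>Independence: the message of user \<open>i\<close> is drawn separately from the
    rest.\<close>
  have "messages_pmf l M \<alpha> = Pi_pmf (insert i ({..<l} - {i})) undefined (\<lambda>_. ?q)"
    using assms(4) by (simp add: messages_pmf_def insert_absorb)
  also have "\<dots> = bind_pmf ?q (\<lambda>w. map_pmf (\<lambda>W. W(i := w)) ?p')"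
    by (subst Pi_pmf_insert') (auto simp: map_pmf_def)
  finally have ex: "measure_pmf.expectation (messages_pmf l M \<alpha>) h
      = (\<Sum>w=0..M. pmf ?q w * measure_pmf.expectation ?p' (\<lambda>W. h (W(i := w))))" for h :: "_ \<Rightarrow> real"
    using fin set_message_pmf[OF assms(1-3)]
    by (subst (asm) (1) HOL.eq_commute, subst HOL.eq_commute, simp)
       (subst pmf_expectation_bind[where A = "{0..M}"], auto)
  define G where "G w = measure_pmf.expectation ?p' (\<lambda>W. \<phi> (W(i := w)))" for w
  \<comment> \<open>The message drawn for user \<open>i\<close> is overwritten, so its probabilities
    just sum to one.\<close>
  have 1: "measure_pmf.expectation (messages_pmf l M \<alpha>) (\<lambda>W. \<phi> (W(i := w))) = G w" for w
    unfolding ex using set_message_pmf[OF assms(1-3)]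
    by (simp add: G_def sum_distrib_right[symmetric] sum_pmf_eq_1)
  have "measure_pmf.expectation (messages_pmf l M \<alpha>) (\<lambda>W. \<phi> W * of_bool (W i \<noteq> 0))
      = (\<Sum>w=0..M. pmf ?q w * (G w * of_bool (w \<noteq> 0)))"
    unfolding ex by (simp add: G_def)
  also have "\<dots> = (\<Sum>w=1..M. \<alpha> / M * G w)"
    unfolding pmf_message_pmf[OF assms(1-3)]
    by (intro sum.mono_neutral_cong_right) auto
  finally show ?thesis unfolding 1 by (simp add: sum_distrib_left sum_divide_distrib)
qed

text \<open>Summing the resampling identity over \<open>S\<close> expresses the left-hand side as
  the mean of \<open>\<phi>\<close> times the number \<open>N\<close> of active users in
  \<open>S\<close>, divided by the mean \<open>K\<close> of \<open>N\<close>. Cauchy-Schwarz and a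
  second moment of \<open>N\<close> of at most \<open>K * (K + 1)\<close> give the bound.\<close>

lemma resample_error_le:
  fixes \<phi> :: "(nat \<Rightarrow> nat) \<Rightarrow> real"
  assumes \<alpha>: "0 < \<alpha>" "\<alpha> \<le> 1" "1 \<le> M" and S: "S \<subseteq> {..<l}" "S \<noteq> {}"
    and \<phi>: "\<And>W. 0 \<le> \<phi> W" "\<And>W. \<phi> W \<le> 1"
  defines "E \<equiv> measure_pmf.expectation (messages_pmf l M \<alpha>)"
  shows "(\<Sum>i\<in>S. (\<Sum>w=1..M. E (\<lambda>W. \<phi> (W(i := w)))) / M) / card S
    \<le> sqrt (E \<phi> * (1 + 1 / (\<alpha> * card S)))"
proof -
  define N where "N W = (\<Sum>i\<in>S. of_bool (W i \<noteq> 0) :: real)" for W :: "nat \<Rightarrow> nat"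
  define K where "K = \<alpha> * card S"
  have finS: "finite S" using S finite_subset by blast
  then have K: "K > 0" and cS: "real (card S) > 0" using S \<alpha> by (auto simp: K_def card_gt_0_iff)
  have \<alpha>': "0 \<le> \<alpha>" using \<alpha> by simp
  note int = integrable_messages[OF \<alpha>' \<alpha>(2,3)]
  let ?p = "pmf (messages_pmf l M \<alpha>)"
  have E: "E h = (\<Sum>W\<in>messages l M. ?p W * h W)" for h
    unfolding E_def by (rule expectation_messages[OF \<alpha>' \<alpha>(2,3)])
  have EN: "E (\<lambda>W. \<psi> W * N W) = \<alpha> * (\<Sum>i\<in>S. (\<Sum>w=1..M. E (\<lambda>W. \<psi> (W(i := w)))) / M)" for \<psi>
  proof -
    have "E (\<lambda>W. \<psi> W * N W) = (\<Sum>i\<in>S. E (\<lambda>W. \<psi> W * of_bool (W i \<noteq> 0)))"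
      unfolding E_def N_def sum_distrib_left by (rule Bochner_Integration.integral_sum) (rule int)
    also have "\<dots> = (\<Sum>i\<in>S. \<alpha> * ((\<Sum>w=1..M. E (\<lambda>W. \<psi> (W(i := w)))) / M))"
      unfolding E_def using S by (intro sum.cong refl expectation_resample[symmetric] \<alpha>' \<alpha>) auto
    finally show ?thesis by (simp add: sum_distrib_left)
  qed
  have mono: "E h \<le> E h'" if "\<And>W. h W \<le> h' W" for h h'
    unfolding E using that by (intro sum_mono mult_left_mono) auto
  have E1: "E (\<lambda>_. c) = c" for c by (simp add: E_def)
  have "E N = K" using EN[of "\<lambda>_. 1"] \<alpha> by (simp add: E1 K_def)
  \<comment> \<open>The resampling identity is applied to \<open>N\<close> itself: changing one
    message raises the number of active users by at most one.\<close>
  have "E (\<lambda>W. N W ^ 2) = \<alpha> * (\<Sum>i\<in>S. (\<Sum>w=1..M. E (\<lambda>W. N (W(i := w)))) / M)"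
    using EN[of N] by (simp add: power2_eq_square)
  also have "\<dots> \<le> \<alpha> * (\<Sum>i\<in>S. (\<Sum>w=1..M. K + 1) / M)"
  proof (intro mult_left_mono sum_mono divide_right_mono)
    fix i w assume "i \<in> S"
    have "N (W(i := w)) \<le> N W + 1" for W
    proof -
      have "N (W(i := w)) = of_bool (w \<noteq> 0) + (\<Sum>j\<in>S-{i}. of_bool (W j \<noteq> 0))"
        unfolding N_def using \<open>i \<in> S\<close> finS by (subst sum.remove[of S i]) auto
      moreover have "N W = of_bool (W i \<noteq> 0) + (\<Sum>j\<in>S-{i}. of_bool (W j \<noteq> 0))"
        unfolding N_def using \<open>i \<in> S\<close> finS by (subst sum.remove[of S i]) auto
      ultimately show ?thesis by simp
    qed
    then have "E (\<lambda>W. N (W(i := w))) \<le> E (\<lambda>W. N W + 1)" by (rule mono)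
    also have "\<dots> = K + 1" using \<open>E N = K\<close> unfolding E_def
      by (subst Bochner_Integration.integral_add) (auto intro: int)
    finally show "E (\<lambda>W. N (W(i := w))) \<le> K + 1" .
  qed (use \<alpha> in auto)
  also have "\<dots> = K * (K + 1)" using \<alpha> by (simp add: K_def)
  finally have EN2: "E (\<lambda>W. N W ^ 2) \<le> K * (K + 1)" .
  have "(E (\<lambda>W. \<phi> W * N W))^2
      = (\<Sum>W\<in>messages l M. (sqrt (?p W) * \<phi> W) * (sqrt (?p W) * N W))^2"
  proof -
    have "?p W * (\<phi> W * N W) = (sqrt (?p W) * sqrt (?p W)) * (\<phi> W * N W)" for W by simp
    then show ?thesis unfolding E by (simp only: mult_ac)
  qed
  also have "\<dots> \<le> (\<Sum>W\<in>messages l M. (sqrt (?p W) * \<phi> W)^2) * (\<Sum>W\<in>messages l M. (sqrt (?p W) * N W)^2)"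
    by (rule Cauchy_Schwarz_ineq_sum)
  also have "\<dots> = E (\<lambda>W. \<phi> W ^ 2) * E (\<lambda>W. N W ^ 2)"
    unfolding E by (simp add: power_mult_distrib)
  \<comment> \<open>The square of \<open>\<phi>\<close> is at most \<open>\<phi>\<close>, because
    its values lie in the unit interval.\<close>
  also have "\<dots> \<le> E \<phi> * (K * (K + 1))"
    using \<phi> by (intro mult_mono mono EN2)
      (auto simp: E power2_eq_square mult_left_le intro!: sum_nonneg)
  finally have "E (\<lambda>W. \<phi> W * N W) \<le> sqrt (E \<phi> * (K * (K + 1)))"
    by (rule real_le_rsqrt)
  then have "E (\<lambda>W. \<phi> W * N W) / K \<le> sqrt (E \<phi> * (K * (K + 1)) / K^2)"
    using K by (simp add: real_sqrt_divide divide_right_mono)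
  also have "E \<phi> * (K * (K + 1)) / K^2 = E \<phi> * (1 + 1 / K)"
    using K by (simp add: field_simps power2_eq_square)
  also have "E (\<lambda>W. \<phi> W * N W) / K = (\<Sum>i\<in>S. (\<Sum>w=1..M. E (\<lambda>W. \<phi> (W(i := w)))) / M) / card S"
    unfolding EN K_def using \<alpha> by simp
  finally show ?thesis unfolding K_def .
qed

subsection \<open>Converse bounds valid for every code\<close>

lemma disjoint_decoding_regions:
  assumes "inj_on W I" shows "disjoint_family_on (\<lambda>i. decoding_region n g (W i)) I"
  using assms by (auto simp: disjoint_family_on_def decoding_region_def inj_on_def)

lemma inj_on_fun_upd: "inj_on (\<lambda>w. W(i := w)) A"
  by (auto simp: inj_on_def dest: fun_upd_eqD)

lemma codeword_fun_upd:
  assumes "i < l"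
  shows "codeword l f (W(i := w)) = (\<lambda>k. codeword l f W k + (f i w k - f i (W i) k))"
proof
  fix k
  have "codeword l f V k = f i (V i) k + (\<Sum>j\<in>{..<l}-{i}. f j (V j) k)" for V
    unfolding codeword_def using assms by (subst sum.remove[of _ i]) auto
  then show "codeword l f (W(i := w)) k = codeword l f W k + (f i w k - f i (W i) k)"
    by (simp cong: sum.cong_simp)
qed

text \<open>Young's inequality compares each shifted probability with that of the same region at the
  common centre \<open>m\<close>, where the disjoint regions have total probability at most
  one.\<close>

lemma sum_success_le:
  assumes "N0 > 0" "p > 1" and I: "finite I" "I \<noteq> {}"
    and D: "disjoint_family_on D I" "\<And>i. i \<in> I \<Longrightarrow> D i \<in> sets (\<Pi>\<^sub>M k\<in>{..<n}. borel)"
    and E: "\<And>i. i \<in> I \<Longrightarrow> inner_n n (x i) (x i) \<le> E"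
  shows "(\<Sum>i\<in>I. shift_prob N0 n (\<lambda>k. m k + x i k) (D i))
    \<le> card I * exp ((p - 1) * (E / N0 - ln (card I) / p))"
proof -
  \<comment> \<open>This \<open>s\<close> balances the two terms of Young's inequality.\<close>
  define s where "s = exp (ln (card I) / p + (p - 1) * E / N0)"
  define T where "T = exp ((p - 1) * (E / N0 - ln (card I) / p))"
  have c: "real (card I) > 0" using I by (simp add: card_gt_0_iff)
  have s: "s powr (1 - p) * exp (p * (p - 1) * E / N0) = T"
    unfolding s_def T_def exp_powr_real exp_add[symmetric]
    using assms by (simp add: field_simps power2_eq_square)
  have s': "s = card I * T"
  proof -
    have "card I * T = exp (ln (card I) + (p - 1) * (E / N0 - ln (card I) / p))"
      using c by (simp add: T_def exp_add)
    also have "ln (card I) + (p - 1) * (E / N0 - ln (card I) / p) = ln (card I) / p + (p - 1) * E / N0"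
      using assms by (simp add: field_simps)
    finally show ?thesis by (simp add: s_def)
  qed
  have "(\<Sum>i\<in>I. shift_prob N0 n (\<lambda>k. m k + x i k) (D i))
      \<le> (\<Sum>i\<in>I. T / p + (1 - 1/p) * s * shift_prob N0 n m (D i))"
  proof (rule sum_mono)
    fix i assume i: "i \<in> I"
    have "exp (p * (p - 1) * inner_n n (x i) (x i) / N0) \<le> exp (p * (p - 1) * E / N0)"
      using E[OF i] assms by (auto intro!: divide_right_mono mult_left_mono)
    then have "s powr (1 - p) / p * exp (p * (p - 1) * inner_n n (x i) (x i) / N0)
        \<le> s powr (1 - p) / p * exp (p * (p - 1) * E / N0)"
      using assms by (intro mult_left_mono) auto
    then show "shift_prob N0 n (\<lambda>k. m k + x i k) (D i) \<le> T / p + (1 - 1/p) * s * shift_prob N0 n m (D i)"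
      using shift_prob_young[OF assms(1) D(2)[OF i] assms(2), of s m "x i"]
      by (simp add: s[symmetric]) (simp add: s_def)
  qed
  also have "\<dots> = card I * T / p + (1 - 1/p) * s * (\<Sum>i\<in>I. shift_prob N0 n m (D i))"
    by (simp add: sum.distrib sum_distrib_left)
  also have "\<dots> \<le> card I * T / p + (1 - 1/p) * s * 1"
    using assms by (intro add_left_mono mult_left_mono sum_shift_prob_le_1) (auto simp: s_def)
  \<comment> \<open>Since \<open>s = card I * T\<close>, the weights \<open>1/p\<close> and
    \<open>1 - 1/p\<close> recombine to one.\<close>
  also have "\<dots> = card I * T" using assms by (simp add: s' field_simps)
  finally show ?thesis by (simp add: T_def)
qed

lemma success_prob_bounds:
  assumes "N0 > 0" shows "0 \<le> success_prob N0 n l f g W" "success_prob N0 n l f g W \<le> 1"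
  using shift_prob_nonneg shift_prob_le_1[OF assms] by (auto simp: success_prob_def)

lemma is_code_expected_error:
  assumes "is_code N0 n l \<alpha> M E \<epsilon> f g" "N0 > 0" "0 \<le> \<alpha>" "\<alpha> \<le> 1"
  shows "measure_pmf.expectation (messages_pmf l M \<alpha>) (\<lambda>W. 1 - success_prob N0 n l f g W) \<le> \<epsilon>"
  using assms error_prob_eq[of \<alpha> M N0 g n l f] by (simp add: is_code_def)

text \<open>The best pair of a user in \<open>S\<close> and a tuple of frozen messages is at least
  as good as the average over \<open>S\<close> and over the law of the messages, which the
  resampling bound controls.\<close>

lemma exists_reliable_user:
  fixes \<alpha> :: real
  assumes code: "is_code N0 n l \<alpha> M E \<epsilon> f g" and "N0 > 0" and \<alpha>: "0 < \<alpha>" "\<alpha> \<le> 1"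
    and S: "S \<subseteq> {..<l}" "S \<noteq> {}"
  obtains i W where "i \<in> S" "W \<in> messages l M"
    "M * (1 - sqrt (\<epsilon> * (1 + 1 / (\<alpha> * card S)))) \<le> (\<Sum>w=1..M. success_prob N0 n l f g (W(i := w)))"
proof -
  let ?\<phi> = "\<lambda>W. 1 - success_prob N0 n l f g W"
  let ?b = "sqrt (\<epsilon> * (1 + 1 / (\<alpha> * card S)))"
  define A where "A = (\<lambda>(i, W). (\<Sum>w=1..M. ?\<phi> (W(i := w))) / M)"
  have M: "1 \<le> M" using code by (simp add: is_code_def)
  have \<alpha>': "0 \<le> \<alpha>" using \<alpha> by simp
  have finS: "finite S" using S finite_subset by blast
  have cS: "real (card S) > 0" using S finS by (auto simp: card_gt_0_iff)
  have ne: "S \<times> messages l M \<noteq> {}" using S by (auto simp: PiE_eq_empty_iff)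
  have fin: "finite (S \<times> messages l M)" using finite_messages finS by simp
  obtain i W where iW: "i \<in> S" "W \<in> messages l M"
    and min: "\<And>j V. j \<in> S \<Longrightarrow> V \<in> messages l M \<Longrightarrow> A (i, W) \<le> A (j, V)"
    using ex_is_arg_min_if_finite[OF fin ne, of A] unfolding is_arg_min_linorder by auto
  have "A (i, W) = (\<Sum>j\<in>S. A (i, W)) / card S" using cS by simp
  also have "\<dots> \<le> (\<Sum>j\<in>S. (\<Sum>w=1..M. measure_pmf.expectation (messages_pmf l M \<alpha>) (\<lambda>V. ?\<phi> (V(j := w)))) / M) / card S"
  proof (intro divide_right_mono sum_mono)
    fix j assume j: "j \<in> S"
    have "A (i, W) = (\<Sum>V\<in>messages l M. pmf (messages_pmf l M \<alpha>) V * A (i, W))"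
      using sum_pmf_eq_1[OF finite_messages set_messages_pmf[OF \<alpha>' \<alpha>(2) M]]
      by (simp add: sum_distrib_right[symmetric])
    also have "\<dots> \<le> (\<Sum>V\<in>messages l M. pmf (messages_pmf l M \<alpha>) V * A (j, V))"
      by (intro sum_mono mult_left_mono min j) auto
    also have "\<dots> = (\<Sum>w=1..M. measure_pmf.expectation (messages_pmf l M \<alpha>) (\<lambda>V. ?\<phi> (V(j := w)))) / M"
      unfolding A_def expectation_messages[OF \<alpha>' \<alpha>(2) M]
      by (subst sum.swap) (simp add: sum_distrib_left sum_divide_distrib)
    finally show "A (i, W) \<le> \<dots>" .
  qed auto
  also have "\<dots> \<le> sqrt (measure_pmf.expectation (messages_pmf l M \<alpha>) ?\<phi> * (1 + 1 / (\<alpha> * card S)))"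
    by (rule resample_error_le) (use \<alpha> M S success_prob_bounds[OF \<open>N0 > 0\<close>] in auto)
  also have "\<dots> \<le> ?b"
    using is_code_expected_error[OF code \<open>N0 > 0\<close> \<alpha>' \<alpha>(2)] \<alpha> by (intro real_sqrt_le_mono mult_right_mono) auto
  finally have "A (i, W) \<le> ?b" .
  then have "M * (1 - ?b) \<le> (\<Sum>w=1..M. success_prob N0 n l f g (W(i := w)))"
    using M by (simp add: A_def sum_subtractf field_simps)
  with iW that show ?thesis by blast
qed

lemma code_rate_bound:
  fixes \<alpha> :: real
  assumes code: "is_code N0 n l \<alpha> M E \<epsilon> f g" and "N0 > 0" and \<alpha>: "0 < \<alpha>" "\<alpha> \<le> 1"
    and "l > 0" "p > 1"
  shows "1 - sqrt (\<epsilon> * (1 + 1 / (\<alpha> * l))) \<le> exp ((p - 1) * (E / N0 - ln M / p))"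
proof -
  obtain i W where iW: "i < l" "W \<in> messages l M"
    and le: "M * (1 - sqrt (\<epsilon> * (1 + 1 / (\<alpha> * l)))) \<le> (\<Sum>w=1..M. success_prob N0 n l f g (W(i := w)))"
    using exists_reliable_user[OF code assms(2) \<alpha>, of "{..<l}"] assms(5) by auto
  have M: "1 \<le> M" and en: "\<And>w. w \<le> M \<Longrightarrow> inner_n n (f i w) (f i w) \<le> E"
    and g: "g \<in> (\<Pi>\<^sub>M k\<in>{..<n}. borel) \<rightarrow>\<^sub>M count_space (messages l M)"
    using code iW by (auto simp: is_code_def)
  note le
  also have "(\<Sum>w=1..M. success_prob N0 n l f g (W(i := w)))
      = (\<Sum>w=1..M. shift_prob N0 n (\<lambda>k. (codeword l f W k - f i (W i) k) + f i w k) (decoding_region n g (W(i := w))))"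
    unfolding success_prob_def codeword_fun_upd[OF iW(1)] by (simp add: algebra_simps)
  also have "\<dots> \<le> card {1..M} * exp ((p - 1) * (E / N0 - ln (card {1..M}) / p))"
    using assms M en
    by (intro sum_success_le disjoint_decoding_regions inj_on_fun_upd decoding_region_sets[OF g]) auto
  finally show ?thesis using M by simp
qed

text \<open>Replacing the message of user \<open>i\<close> by \<open>w\<close> moves the output by a
  vector of energy at most \<open>4 * E\<close>, and these moves are orthogonal for different
  \<open>i\<close>. By the chi-square bound a tuple that is decoded well is still decoded when a
  random user has been resampled, which is then an error unless the message has not changed. For
  small \<epsilon> this forces \<open>E\<close> to grow like \<open>ln l\<close>.\<close>

lemma code_energy_bound:
  fixes \<alpha> :: real
  assumes code: "is_code N0 n l \<alpha> M E \<epsilon> f g" and orth: "orthogonal_access n l M f"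
    and "N0 > 0" and \<alpha>: "0 < \<alpha>" "\<alpha> \<le> 1" and "l > 0" "2 \<le> M"
  shows "1 / 2 \<le> \<epsilon> + sqrt (exp (8 * E / N0) / l) + sqrt (\<epsilon> * (1 + 1 / (\<alpha> * l)))"
proof -
  let ?P = "success_prob N0 n l f g"
  let ?\<phi> = "\<lambda>W. 1 - ?P W"
  let ?c = "sqrt (exp (8 * E / N0) / l)"
  let ?E = "measure_pmf.expectation (messages_pmf l M \<alpha>)"
  have M: "1 \<le> M" and en: "\<And>i w. i < l \<Longrightarrow> w \<le> M \<Longrightarrow> inner_n n (f i w) (f i w) \<le> E"
    and g: "g \<in> (\<Pi>\<^sub>M k\<in>{..<n}. borel) \<rightarrow>\<^sub>M count_space (messages l M)"
    using code by (auto simp: is_code_def)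
  have \<alpha>': "0 \<le> \<alpha>" using \<alpha> by simp
  note int = integrable_messages[OF \<alpha>' \<alpha>(2) M]
  have ptw: "?P W \<le> ?c + (\<Sum>i<l. (\<Sum>w=1..M. ?\<phi> (W(i := w))) / M) / l + 1 / M" if W: "W \<in> messages l M" for W
  proof -
    have Wi: "W i \<le> M" if "i < l" for i using PiE_mem[OF W, of i] that by simp
    have *: "?P W - (\<Sum>i<l. ?\<phi> (W(i := w)) + of_bool (W i = w)) / l \<le> ?c" if w: "w \<in> {1..M}" for w
    proof -
      let ?x = "\<lambda>i k. f i w k - f i (W i) k"
      have "?P W - (\<Sum>i<l. shift_prob N0 n (\<lambda>k. codeword l f W k + ?x i k) (decoding_region n g W)) / card {..<l}
          \<le> sqrt (exp (2 * (4 * E) / N0) / card {..<l})"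
        unfolding success_prob_def
      proof (rule shift_prob_chi_square)
        fix i j assume ij: "i \<in> {..<l}" "j \<in> {..<l}" "i \<noteq> j"
        show "inner_n n (?x i) (?x j) = 0"
          using orth ij w Wi[of i] Wi[of j] unfolding orthogonal_access_def by (simp add: inner_n_linear)
      next
        fix i assume i: "i \<in> {..<l}"
        show "inner_n n (?x i) (?x i) \<le> 4 * E"
          using inner_n_diff_le[of n "f i w" "f i (W i)"] en[of i w] en[of i "W i"] i w Wi[of i] by auto
      qed (use assms in \<open>auto intro: decoding_region_sets[OF g]\<close>)
      \<comment> \<open>Decoding the output of \<open>W(i := w)\<close> as \<open>W\<close> is an
        error of the resampled tuple, except when the two tuples coincide.\<close>
      moreover have "shift_prob N0 n (\<lambda>k. codeword l f W k + ?x i k) (decoding_region n g W)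
          \<le> ?\<phi> (W(i := w)) + of_bool (W i = w)" if i: "i < l" for i
      proof (cases "W i = w")
        case True
        then show ?thesis
          using shift_prob_le_1[OF assms(3), of n "codeword l f W" "decoding_region n g W"]
              success_prob_bounds(2)[OF assms(3), of n l f g "W(i := w)"] by simp
      next
        case False
        then have "W \<noteq> W(i := w)" by (metis fun_upd_same)
        then have "(\<Sum>V\<in>{W, W(i := w)}. shift_prob N0 n (codeword l f (W(i := w))) (decoding_region n g V)) \<le> 1"
          by (intro sum_shift_prob_le_1 disjoint_decoding_regions decoding_region_sets[OF g] assms) auto
        with \<open>W \<noteq> W(i := w)\<close> False show ?thesis
          by (simp add: success_prob_def codeword_fun_upd[OF i] del: fun_upd_apply)
      qed
      then have "(\<Sum>i<l. shift_prob N0 n (\<lambda>k. codeword l f W k + ?x i k) (decoding_region n g W)) / l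
          \<le> (\<Sum>i<l. ?\<phi> (W(i := w)) + of_bool (W i = w)) / l"
        by (intro divide_right_mono sum_mono) auto
      ultimately show ?thesis by simp
    qed
    \<comment> \<open>Averaging over \<open>w\<close>: each user has at most one \<open>w\<close>
      equal to its own message, so coincidences cost \<open>1 / M\<close>, which is at most one
      half.\<close>
    have "M * ?P W - (\<Sum>i<l. (\<Sum>w=1..M. ?\<phi> (W(i := w)))) / l - M / M
        \<le> M * ?P W - (\<Sum>i<l. (\<Sum>w=1..M. ?\<phi> (W(i := w)))) / l - (\<Sum>i<l. \<Sum>w=1..M. of_bool (W i = w)) / l"
    proof -
      have "(\<Sum>i<l. \<Sum>w=1..M. of_bool (W i = w)) \<le> (\<Sum>i<l. 1 :: real)"
        by (intro sum_mono) (simp add: of_bool_def)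
      then show ?thesis using assms(6) M by (simp add: field_simps)
    qed
    also have "\<dots> = (\<Sum>w=1..M. ?P W - (\<Sum>i<l. ?\<phi> (W(i := w)) + of_bool (W i = w)) / l)"
    proof -
      have "(\<Sum>w=1..M. c - (\<Sum>i<l. F i w + G i w) / l)
          = M * c - (\<Sum>i<l. \<Sum>w=1..M. F i w) / l - (\<Sum>i<l. \<Sum>w=1..M. G i w) / l"
        for c :: real and F G :: "nat \<Rightarrow> nat \<Rightarrow> real"
        using sum.swap[of F "{1..M}" "{..<l}"] sum.swap[of G "{1..M}" "{..<l}"]
        by (simp add: sum_subtractf sum.distrib add_divide_distrib flip: sum_divide_distrib)
      from this[of "?P W" "\<lambda>i w. ?\<phi> (W(i := w))" "\<lambda>i w. of_bool (W i = w)"] show ?thesis by (rule sym)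
    qed
    also have "\<dots> \<le> (\<Sum>w=1..M. ?c)" by (intro sum_mono *)
    finally have "M * ?P W \<le> M * ?c + (\<Sum>i<l. (\<Sum>w=1..M. ?\<phi> (W(i := w)))) / l + 1"
      using M by simp
    then have "M * ?P W / M \<le> (M * ?c + (\<Sum>i<l. (\<Sum>w=1..M. ?\<phi> (W(i := w)))) / l + 1) / M"
      using M by (intro divide_right_mono) auto
    then show ?thesis
      using M by (simp add: add_divide_distrib sum_divide_distrib[symmetric] mult.commute)
  qed
  have "1 - \<epsilon> \<le> ?E ?P"
    using is_code_expected_error[OF code \<open>N0 > 0\<close> \<alpha>' \<alpha>(2)]
    by (subst (asm) Bochner_Integration.integral_diff) (auto intro: int)
  also have "?E ?P \<le> ?E (\<lambda>W. (\<Sum>i<l. (\<Sum>w=1..M. ?\<phi> (W(i := w))) / M) / l + (?c + 1 / M))"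
    unfolding expectation_messages[OF \<alpha>' \<alpha>(2) M]
    using ptw by (intro sum_mono mult_left_mono) (auto simp: add_ac)
  also have "\<dots> = (\<Sum>i\<in>{..<l}. (\<Sum>w=1..M. ?E (\<lambda>W. ?\<phi> (W(i := w)))) / M) / card {..<l} + (?c + 1 / M)"
    by (subst Bochner_Integration.integral_add)
       (auto intro!: int simp: Bochner_Integration.integral_sum[OF int])
  also have "(\<Sum>i\<in>{..<l}. (\<Sum>w=1..M. ?E (\<lambda>W. ?\<phi> (W(i := w)))) / M) / card {..<l}
      \<le> sqrt (?E ?\<phi> * (1 + 1 / (\<alpha> * card {..<l})))"
    by (rule resample_error_le) (use \<alpha> M assms success_prob_bounds[OF \<open>N0 > 0\<close>] in auto)
  also have "\<dots> \<le> sqrt (\<epsilon> * (1 + 1 / (\<alpha> * l)))"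
    using is_code_expected_error[OF code \<open>N0 > 0\<close> \<alpha>' \<alpha>(2)] \<alpha> by (intro real_sqrt_le_mono) (simp add: mult_right_mono)
  finally have "1 - \<epsilon> \<le> sqrt (\<epsilon> * (1 + 1 / (\<alpha> * l))) + (?c + 1 / M)" by simp
  moreover have "1 / real M \<le> 1 / 2" using assms by (intro divide_left_mono) auto
  ultimately show ?thesis by linarith
qed

subsection \<open>Users confined to few dimensions\<close>

text \<open>Members that agree below \<open>n\<close> have inner product one and are therefore equal
  as functions, so the cardinality of \<open>B\<close> is a true dimension.\<close>

definition orthonormal :: "nat \<Rightarrow> (nat \<Rightarrow> real) set \<Rightarrow> bool" where
  "orthonormal n B \<longleftrightarrow> finite B \<and> (\<forall>u\<in>B. \<forall>v\<in>B. inner_n n u v = of_bool (u = v))"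

lemma inner_n_cong:
  "(\<And>k. k < n \<Longrightarrow> x k = x' k) \<Longrightarrow> (\<And>k. k < n \<Longrightarrow> y k = y' k) \<Longrightarrow> inner_n n x y = inner_n n x' y'"
  by (simp add: inner_n_def)

lemma orthonormal_inner_sum:
  assumes "orthonormal n B" "u \<in> B"
  shows "inner_n n (\<lambda>k. \<Sum>v\<in>B. c v * v k) u = c u"
proof -
  have "inner_n n (\<lambda>k. \<Sum>v\<in>B. c v * v k) u = (\<Sum>v\<in>B. c v * of_bool (v = u))"
    using assms by (simp add: inner_n_linear orthonormal_def)
  also have "\<dots> = (\<Sum>v\<in>B. if v = u then c v else 0)" by (intro sum.cong) auto
  also have "\<dots> = c u" using assms by (simp add: orthonormal_def)
  finally show ?thesis .
qed

lemma orthonormal_norm_sum: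
  assumes "orthonormal n B"
  shows "inner_n n (\<lambda>k. \<Sum>v\<in>B. c v * v k) (\<lambda>k. \<Sum>v\<in>B. c v * v k) = (\<Sum>v\<in>B. c v ^ 2)"
  by (subst inner_n_sum_right) (simp add: inner_n_scale_right orthonormal_inner_sum[OF assms] power2_eq_square)

text \<open>Bessel's inequality for the \<open>k\<close>-th coordinate vector bounds the sum of the
  squares \<open>u k ^ 2\<close> by one; summing over \<open>k\<close> gives the number of unit
  vectors.\<close>

lemma card_orthonormal_le:
  assumes "orthonormal n B" shows "card B \<le> n"
proof -
  have *: "(\<Sum>u\<in>B. u k ^ 2) \<le> 1" if "k < n" for k
  proof -
    let ?e = "\<lambda>j. of_bool (j = k) :: real" and ?p = "\<lambda>j. \<Sum>u\<in>B. u k * u j"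
    have e: "inner_n n ?e x = x k" for x
    proof -
      have "inner_n n ?e x = (\<Sum>j<n. if j = k then x j else 0)"
        unfolding inner_n_def by (intro sum.cong) auto
      then show ?thesis using that by simp
    qed
    \<comment> \<open>\<open>?p\<close> is the projection of the coordinate vector \<open>?e\<close>
      onto the span of \<open>B\<close>.\<close>
    have "0 \<le> inner_n n (\<lambda>j. ?e j - ?p j) (\<lambda>j. ?e j - ?p j)" by (rule inner_n_nonneg)
    also have "\<dots> = inner_n n ?e ?e - 2 * inner_n n ?e ?p + inner_n n ?p ?p"
      by (simp only: inner_n_diff_left inner_n_diff_right inner_n_commute[of n ?p ?e])
    also have "\<dots> = 1 - (\<Sum>u\<in>B. u k ^ 2)"
      unfolding e orthonormal_norm_sum[OF assms] by (simp add: power2_eq_square)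
    finally show ?thesis by simp
  qed
  have "real (card B) = (\<Sum>u\<in>B. inner_n n u u)" using assms by (simp add: orthonormal_def)
  also have "\<dots> = (\<Sum>k<n. \<Sum>u\<in>B. u k ^ 2)"
    unfolding inner_n_def by (subst sum.swap) (simp add: power2_eq_square)
  also have "\<dots> \<le> (\<Sum>k<n. 1)" by (intro sum_mono *) auto
  finally show ?thesis by simp
qed

text \<open>Gram-Schmidt, adding the normalised residual of each new vector. The last conjunct
  expresses in dual form that the basis lies in the span of \<open>F\<close>, which lets
  orthogonality of codewords pass to the bases.\<close>

lemma exists_orthonormal_basis:
  assumes "finite F"
  shows "\<exists>B. orthonormal n B \<and> (\<forall>x\<in>F. \<forall>k<n. x k = (\<Sum>u\<in>B. inner_n n x u * u k))
    \<and> (\<forall>y. (\<forall>x\<in>F. inner_n n x y = 0) \<longrightarrow> (\<forall>u\<in>B. inner_n n u y = 0))"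
  using assms
proof induction
  case empty
  show ?case by (intro exI[of _ "{}"]) (simp add: orthonormal_def)
next
  case (insert x F)
  then obtain B where B: "orthonormal n B"
    and span: "\<And>y k. y \<in> F \<Longrightarrow> k < n \<Longrightarrow> y k = (\<Sum>u\<in>B. inner_n n y u * u k)"
    and perp: "\<And>y u. (\<And>x. x \<in> F \<Longrightarrow> inner_n n x y = 0) \<Longrightarrow> u \<in> B \<Longrightarrow> inner_n n u y = 0"
    by (elim exE conjE) blast
  define r where "r = (\<lambda>k. x k - (\<Sum>u\<in>B. inner_n n x u * u k))"
  have fin: "finite B" using B by (simp add: orthonormal_def)
  have rB: "inner_n n r u = 0" if "u \<in> B" for u
    unfolding r_def by (subst inner_n_diff_left) (simp add: orthonormal_inner_sum[OF B that])
  show ?case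
  proof (cases "inner_n n r r = 0")
    case True
    then have "\<forall>k<n. r k = 0" by (simp add: inner_n_def sum_nonneg_eq_0_iff)
    then have "x k = (\<Sum>u\<in>B. inner_n n x u * u k)" if "k < n" for k using that by (simp add: r_def)
    then show ?thesis using B span perp by (intro exI[of _ B]) auto
  next
    case False
    define c where "c = sqrt (inner_n n r r)"
    have c: "c > 0" "c * c = inner_n n r r"
      using False inner_n_nonneg[of n r] by (auto simp: c_def less_le)
    define v where "v = (\<lambda>k. (1 / c) * r k)"
    have vB: "inner_n n v u = 0" "inner_n n u v = 0" if "u \<in> B" for u
      using rB[OF that] unfolding v_def inner_n_commute[of n u] inner_n_scale_left by auto
    have vv: "inner_n n v v = 1"
      unfolding v_def inner_n_scale_left inner_n_scale_right using c False by simp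
    have nv: "v \<notin> B" using vB vv by fastforce
    have "orthonormal n (insert v B)"
      using B vB vv nv unfolding orthonormal_def by auto
    moreover have "y k = (\<Sum>u\<in>insert v B. inner_n n y u * u k)" if y: "y \<in> insert x F" and k: "k < n" for y k
    proof (cases "y = x")
      case True
      have "x = (\<lambda>k. r k + (\<Sum>u\<in>B. inner_n n x u * u k))" by (simp add: r_def)
      then have "inner_n n x v = inner_n n (\<lambda>k. r k + (\<Sum>u\<in>B. inner_n n x u * u k)) v" by simp
      also have "\<dots> = inner_n n r v + (\<Sum>u\<in>B. inner_n n x u * inner_n n u v)"
        by (simp only: inner_n_linear)
      also have "\<dots> = inner_n n r r / c" using vB by (simp add: inner_n_scale_right[of n r "1 / c" r, folded v_def])
      also have "\<dots> = c" using c by (simp flip: c(2))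
      finally have "inner_n n x v * v k = r k" using c by (simp add: v_def[THEN fun_cong])
      then show ?thesis using True fin nv by (simp add: r_def)
    next
      case False
      then have yF: "y \<in> F" using y by simp
      have "inner_n n y v = inner_n n (\<lambda>k. \<Sum>u\<in>B. inner_n n y u * u k) v"
        using span[OF yF] by (intro inner_n_cong) auto
      also have "\<dots> = 0" using vB by (simp add: inner_n_linear)
      finally show ?thesis using span[OF yF k] fin nv by simp
    qed
    moreover have "inner_n n u y = 0" if y: "\<And>z. z \<in> insert x F \<Longrightarrow> inner_n n z y = 0" and u: "u \<in> insert v B" for y u
    proof -
      have By: "inner_n n u y = 0" if "u \<in> B" for u using perp[of y u] y that by auto
      have "inner_n n r y = 0" unfolding r_def using y By by (simp add: inner_n_linear)
      then show ?thesis using u By by (auto simp: inner_n_scale_left[of n "1 / c" r, folded v_def])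
    qed
    ultimately show ?thesis by blast
  qed
qed

section \<open>Counting codewords after rounding\<close>

text \<open>The nonnegative and the nonpositive integers each give a geometric series; counting zero
  twice only enlarges the bound.\<close>

lemma geometric_int_sum_le:
  fixes c :: real
  assumes "c > 0"
  shows "(\<Sum>j=-int R..int R. exp (- c * \<bar>j\<bar>)) \<le> 2 / (1 - exp (- c))"
proof -
  have "(\<Sum>j=-int R..int R. exp (- c * \<bar>j\<bar>)) \<le> (\<Sum>j\<in>int ` {..R} \<union> (\<lambda>k. - int k) ` {..R}. exp (- c * \<bar>j\<bar>))"
  proof (rule sum_mono2)
    show "{- int R..int R} \<subseteq> int ` {..R} \<union> (\<lambda>k. - int k) ` {..R}"
    proof
      fix j assume j: "j \<in> {- int R..int R}"
      show "j \<in> int ` {..R} \<union> (\<lambda>k. - int k) ` {..R}"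
      proof (cases "j \<ge> 0")
        case True
        then have "j = int (nat j)" "nat j \<in> {..R}" using j by auto
        then show ?thesis by blast
      next
        case False
        then have "j = - int (nat (-j))" "nat (-j) \<in> {..R}" using j by auto
        then show ?thesis by blast
      qed
    qed
  qed auto
  also have "\<dots> \<le> (\<Sum>j\<in>int ` {..R}. exp (- c * \<bar>j\<bar>)) + (\<Sum>j\<in>(\<lambda>k. - int k) ` {..R}. exp (- c * \<bar>j\<bar>))"
    by (subst sum_Un) (auto intro!: sum_nonneg)
  also have "\<dots> = 2 * (\<Sum>k\<le>R. exp (- c) ^ k)"
    by (subst (1 2) sum.reindex) (auto simp: inj_on_def exp_of_nat_mult[symmetric] mult.commute)
  also have "(\<Sum>k\<le>R. exp (- c) ^ k) \<le> (\<Sum>k. exp (- c) ^ k)"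
    using assms by (intro sum_le_suminf summable_geometric) auto
  also have "\<dots> = 1 / (1 - exp (- c))" using assms by (intro suminf_geometric) auto
  finally show ?thesis by simp
qed

text \<open>Exponential weighting: every member of \<open>Q\<close> has weight at least one under
  \<open>exp (c * (L - S))\<close>, where \<open>S\<close> is the sum of its absolute values, and
  the total weight over a box factors over \<open>B\<close>. Extensionality makes a function
  determined by its values on \<open>B\<close>.\<close>

lemma card_int_functions_le:
  fixes c :: real
  assumes "finite B" "c > 0" and Q: "Q \<subseteq> extensional B"
    and L: "\<And>q. q \<in> Q \<Longrightarrow> (\<Sum>u\<in>B. real_of_int \<bar>q u\<bar>) \<le> L"
  shows "finite Q" "real (card Q) \<le> exp (c * L) * (2 / (1 - exp (- c))) ^ card B"
proof -
  define R where "R = nat \<lceil>L\<rceil>"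
  let ?P = "\<Pi>\<^sub>E u\<in>B. {- int R..int R}"
  have sub: "Q \<subseteq> ?P"
  proof
    fix q assume q: "q \<in> Q"
    have *: "\<bar>q u\<bar> \<le> int R" if "u \<in> B" for u
    proof -
      have "real_of_int \<bar>q u\<bar> \<le> (\<Sum>u\<in>B. real_of_int \<bar>q u\<bar>)"
        using that assms(1) by (intro member_le_sum) auto
      then have "real_of_int \<bar>q u\<bar> \<le> L" using L[OF q] by simp
      then show ?thesis unfolding R_def by linarith
    qed
    have "q u \<in> {- int R..int R}" if "u \<in> B" for u using *[OF that] by auto
    with Q q show "q \<in> ?P" unfolding PiE_iff by blast
  qed
  have fin: "finite ?P" using assms(1) by (intro finite_PiE) auto
  then show "finite Q" using sub finite_subset by blast
  have "real (card Q) = (\<Sum>q\<in>Q. 1)" by simp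
  also have "\<dots> \<le> (\<Sum>q\<in>Q. exp (c * L) * (\<Prod>u\<in>B. exp (- c * \<bar>q u\<bar>)))"
  proof (rule sum_mono)
    fix q assume "q \<in> Q"
    have "(\<Prod>u\<in>B. exp (- c * \<bar>q u\<bar>)) = exp (- c * (\<Sum>u\<in>B. real_of_int \<bar>q u\<bar>))"
      using assms(1) by (simp add: exp_sum sum_distrib_left)
    then have "exp (c * L) * (\<Prod>u\<in>B. exp (- c * \<bar>q u\<bar>))
        = exp (c * (L - (\<Sum>u\<in>B. real_of_int \<bar>q u\<bar>)))"
      by (simp only: exp_add[symmetric] right_diff_distrib) simp
    then show "1 \<le> exp (c * L) * (\<Prod>u\<in>B. exp (- c * \<bar>q u\<bar>))"
      using L[OF \<open>q \<in> Q\<close>] assms(2) by simp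
  qed
  also have "\<dots> \<le> (\<Sum>q\<in>?P. exp (c * L) * (\<Prod>u\<in>B. exp (- c * \<bar>q u\<bar>)))"
    by (intro sum_mono2 fin sub mult_nonneg_nonneg prod_nonneg ballI) auto
  also have "\<dots> = exp (c * L) * (\<Prod>u\<in>B. \<Sum>j=-int R..int R. exp (- c * \<bar>j\<bar>))"
    using assms(1) by (subst prod_sum_PiE) (auto simp: sum_distrib_left)
  also have "\<dots> \<le> exp (c * L) * (\<Prod>u\<in>B. 2 / (1 - exp (- c)))"
    using geometric_int_sum_le[OF assms(2), of R]
    by (intro mult_left_mono prod_mono conjI sum_nonneg) auto
  finally show "real (card Q) \<le> exp (c * L) * (2 / (1 - exp (- c))) ^ card B" by simp
qed

text \<open>The number of rounding cells is exponential in \<open>c * E\<close> with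
  \<open>c\<close> as small as desired, the price being a constant factor for each dimension. In low
  dimension this improves on the bound given by energy alone.\<close>

lemma sum_success_low_dim_le:
  fixes c :: real
  assumes "N0 > 0" "c > 0" and I: "finite I"
    and D: "disjoint_family_on D I" "\<And>i. i \<in> I \<Longrightarrow> D i \<in> sets (\<Pi>\<^sub>M k\<in>{..<n}. borel)"
    and E: "\<And>i. i \<in> I \<Longrightarrow> inner_n n (x i) (x i) \<le> E"
    and B: "orthonormal n B" "\<And>i k. i \<in> I \<Longrightarrow> k < n \<Longrightarrow> x i k = (\<Sum>u\<in>B. inner_n n (x i) u * u k)"
  shows "(\<Sum>i\<in>I. shift_prob N0 n (\<lambda>k. m k + x i k) (D i))
    \<le> card I / 4 + exp (2 * real (card B) / N0) * (exp (c * (E + 2 * real (card B))) * (2 / (1 - exp (- c))) ^ card B)"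
proof -
  define a where "a i u = inner_n n (x i) u" for i u
  \<comment> \<open>Rounding moves a codeword by at most \<open>sqrt (card B)\<close>; codewords with the same key then share a
    centre \<open>y q\<close>, at which their disjoint decoding regions have total probability at most 1.\<close>
  define key where "key i = (\<lambda>u\<in>B. \<lfloor>a i u\<rfloor>)" for i
  define y where "y q k = (\<Sum>u\<in>B. real_of_int (q u) * u k)" for q k
  have fB: "finite B" using B by (simp add: orthonormal_def)
  have "(\<Sum>i\<in>I. shift_prob N0 n (\<lambda>k. m k + x i k) (D i))
      \<le> (\<Sum>i\<in>I. 1 / 4 + exp (2 * real (card B) / N0) * shift_prob N0 n (\<lambda>k. m k + y (key i) k) (D i))"
  proof (rule sum_mono)
    fix i assume i: "i \<in> I"
    define d where "d k = (\<Sum>u\<in>B. (a i u - \<lfloor>a i u\<rfloor>) * u k)" for k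
    have "shift_prob N0 n (\<lambda>k. m k + x i k) (D i) = shift_prob N0 n (\<lambda>k. (m k + y (key i) k) + d k) (D i)"
      using B(2)[OF i]
      by (intro shift_prob_cong) (simp add: y_def d_def key_def a_def left_diff_distrib sum_subtractf)
    \<comment> \<open>Young's inequality with \<open>p = 2\<close>; this \<open>s\<close> makes the
      first term at most \<open>1 / 4\<close>, as the rounding error \<open>d\<close> has energy at
      most \<open>card B\<close>.\<close>
    also have "\<dots> \<le> (2 * exp (2 * real (card B) / N0)) powr (1 - 2) / 2 * exp (2 * (2 - 1) * inner_n n d d / N0)
        + (1 - 1/2) * (2 * exp (2 * real (card B) / N0)) * shift_prob N0 n (\<lambda>k. m k + y (key i) k) (D i)"
      using assms i by (intro shift_prob_young) auto
    also have "inner_n n d d \<le> card B"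
    proof -
      have "inner_n n d d = (\<Sum>u\<in>B. (a i u - \<lfloor>a i u\<rfloor>)^2)"
        unfolding d_def by (rule orthonormal_norm_sum[OF B(1)])
      also have "\<dots> \<le> (\<Sum>u\<in>B. 1)"
      proof (rule sum_mono)
        fix u
        have "0 \<le> a i u - \<lfloor>a i u\<rfloor>" "a i u - \<lfloor>a i u\<rfloor> \<le> 1" by linarith+
        then show "(a i u - \<lfloor>a i u\<rfloor>)^2 \<le> 1" by (simp add: power_le_one)
      qed
      finally show ?thesis by simp
    qed
    also have "(2 * exp (2 * real (card B) / N0)) powr (1 - 2) / 2 * exp (2 * (2 - 1) * real (card B) / N0) = 1 / 4"
      by (simp add: powr_minus field_simps)
    finally show "shift_prob N0 n (\<lambda>k. m k + x i k) (D i)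
        \<le> 1 / 4 + exp (2 * real (card B) / N0) * shift_prob N0 n (\<lambda>k. m k + y (key i) k) (D i)"
      using assms(1) by (simp add: divide_right_mono)
  qed
  also have "\<dots> = card I / 4 + exp (2 * real (card B) / N0) * (\<Sum>i\<in>I. shift_prob N0 n (\<lambda>k. m k + y (key i) k) (D i))"
    by (simp add: sum.distrib sum_distrib_left)
  also have "(\<Sum>i\<in>I. shift_prob N0 n (\<lambda>k. m k + y (key i) k) (D i))
      = (\<Sum>q\<in>key ` I. \<Sum>i\<in>{i\<in>I. key i = q}. shift_prob N0 n (\<lambda>k. m k + y (key i) k) (D i))"
    using I by (rule sum.image_gen)
  also have "\<dots> = (\<Sum>q\<in>key ` I. \<Sum>i\<in>{i\<in>I. key i = q}. shift_prob N0 n (\<lambda>k. m k + y q k) (D i))"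
    by (intro sum.cong) auto
  also have "\<dots> \<le> (\<Sum>q\<in>key ` I. 1)"
    using assms by (intro sum_mono sum_shift_prob_le_1) (auto simp: disjoint_family_on_def)
  also have "\<dots> = real (card (key ` I))" by simp
  also have "\<dots> \<le> exp (c * (E + 2 * real (card B))) * (2 / (1 - exp (- c))) ^ card B"
  proof (rule card_int_functions_le(2)[OF fB assms(2)])
    fix q assume "q \<in> key ` I"
    then obtain i where i: "i \<in> I" "q = key i" by blast
    \<comment> \<open>The bound of \<open>\<bar>a\<bar>\<close> by \<open>a^2 + 1\<close> trades the
      sum of absolute values for the energy, the remaining one being due to the floor.\<close>
    have "(\<Sum>u\<in>B. real_of_int \<bar>q u\<bar>) \<le> (\<Sum>u\<in>B. a i u ^ 2 + 2)"
    proof (rule sum_mono)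
      fix u assume "u \<in> B"
      have "real_of_int \<bar>\<lfloor>a i u\<rfloor>\<bar> \<le> \<bar>a i u\<bar> + 1" by linarith
      also have "\<bar>a i u\<bar> \<le> a i u ^ 2 + 1"
        using zero_le_power2[of "\<bar>a i u\<bar> - 1/2"] by (simp add: power2_diff power_divide)
      finally show "real_of_int \<bar>q u\<bar> \<le> a i u ^ 2 + 2" using i \<open>u \<in> B\<close> by (simp add: key_def)
    qed
    also have "\<dots> = (\<Sum>u\<in>B. a i u ^ 2) + 2 * real (card B)" by (simp add: sum.distrib)
    also have "(\<Sum>u\<in>B. a i u ^ 2) = inner_n n (x i) (x i)"
      unfolding orthonormal_norm_sum[OF B(1), symmetric] using B(2)[OF i(1)]
      by (intro inner_n_cong) (auto simp: a_def)
    finally show "(\<Sum>u\<in>B. real_of_int \<bar>q u\<bar>) \<le> E + 2 * real (card B)" using E[OF i(1)] by simp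
  qed (auto simp: key_def)
  finally show ?thesis by simp
qed

text \<open>The spans of different users are orthogonal, so their dimensions add up to at most
  \<open>n\<close> and at least half of the users have dimension at most \<open>d\<close>. A
  reliable user is chosen within this half, whence the \<open>2 / (\<alpha> * l)\<close> in the
  condition on \<epsilon>.\<close>

lemma code_low_dim_bound:
  fixes \<alpha> c :: real
  assumes code: "is_code N0 n l \<alpha> M E \<epsilon> f g" and orth: "orthogonal_access n l M f"
    and "N0 > 0" "c > 0" and \<alpha>: "0 < \<alpha>" "\<alpha> \<le> 1" and "l > 0" "n > 0"
    and \<epsilon>: "\<epsilon> * (1 + 2 / (\<alpha> * l)) \<le> 1 / 16"
  defines "d \<equiv> 2 * real n / real l"
  shows "ln M \<le> ln 2 + 2 * d / N0 + c * (E + 2 * d) + d * ln (2 / (1 - exp (- c)))"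
proof -
  have M: "1 \<le> M" and en: "\<And>i w. i < l \<Longrightarrow> w \<le> M \<Longrightarrow> inner_n n (f i w) (f i w) \<le> E"
    and g: "g \<in> (\<Pi>\<^sub>M k\<in>{..<n}. borel) \<rightarrow>\<^sub>M count_space (messages l M)" and \<epsilon>0: "0 \<le> \<epsilon>"
    using code by (auto simp: is_code_def)
  have "\<forall>i. \<exists>B. orthonormal n B \<and> (\<forall>x\<in>f i ` {0..M}. \<forall>k<n. x k = (\<Sum>u\<in>B. inner_n n x u * u k))
    \<and> (\<forall>y. (\<forall>x\<in>f i ` {0..M}. inner_n n x y = 0) \<longrightarrow> (\<forall>u\<in>B. inner_n n u y = 0))"
    by (intro allI exists_orthonormal_basis) auto
  from choice[OF this] obtain B where basis: "\<And>i. orthonormal n (B i)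
    \<and> (\<forall>x\<in>f i ` {0..M}. \<forall>k<n. x k = (\<Sum>u\<in>B i. inner_n n x u * u k))
    \<and> (\<forall>y. (\<forall>x\<in>f i ` {0..M}. inner_n n x y = 0) \<longrightarrow> (\<forall>u\<in>B i. inner_n n u y = 0))"
    by blast
  have B: "orthonormal n (B i)" for i using basis[of i] by (rule conjunct1)
  have span: "f i w k = (\<Sum>u\<in>B i. inner_n n (f i w) u * u k)" if "w \<le> M" "k < n" for i w k
    using basis[of i, THEN conjunct2, THEN conjunct1] that by simp
  have perp: "inner_n n u y = 0" if "\<And>w. w \<le> M \<Longrightarrow> inner_n n (f i w) y = 0" "u \<in> B i" for i y u
    by (rule basis[of i, THEN conjunct2, THEN conjunct2, rule_format, OF _ that(2)]) (use that(1) in auto)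
  \<comment> \<open>\<open>perp\<close> is used twice, first to replace the codewords of
    \<open>j\<close> by its basis and then those of \<open>i\<close>.\<close>
  have cross: "inner_n n u v = 0" if "u \<in> B i" "v \<in> B j" "i < l" "j < l" "i \<noteq> j" for u v i j
  proof (rule perp[OF _ that(1)])
    fix w assume w: "w \<le> M"
    have "inner_n n v (f i w) = 0"
      by (rule perp[OF _ that(2)]) (use orth that w in \<open>auto simp: orthogonal_access_def\<close>)
    then show "inner_n n (f i w) v = 0" by (simp add: inner_n_commute)
  qed
  have fB: "finite (B i)" and one: "u \<in> B i \<Longrightarrow> inner_n n u u = 1" for i u
    using B[of i] by (auto simp: orthonormal_def)
  have disj: "B i \<inter> B j = {}" if "i < l" "j < l" "i \<noteq> j" for i j
    using cross[OF _ _ that] one by fastforce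
  have "orthonormal n (\<Union>i<l. B i)"
    unfolding orthonormal_def
  proof (intro conjI ballI)
    fix u v assume "u \<in> (\<Union>i<l. B i)" "v \<in> (\<Union>i<l. B i)"
    then obtain i j where ij: "i < l" "j < l" "u \<in> B i" "v \<in> B j" by auto
    show "inner_n n u v = of_bool (u = v)"
    proof (cases "i = j")
      case True then show ?thesis using B[of i] ij by (auto simp: orthonormal_def)
    next
      case False
      then have "u \<noteq> v" using disj[OF ij(1,2)] ij by auto
      then show ?thesis using cross[OF ij(3,4,1,2) False] by simp
    qed
  qed (use fB in auto)
  then have "card (\<Union>i<l. B i) \<le> n" by (rule card_orthonormal_le)
  then have sum_card: "(\<Sum>i<l. card (B i)) \<le> n"
    using fB disj by (subst (asm) card_UN_disjoint) auto
  define S where "S = {i. i < l \<and> real (card (B i)) \<le> d}"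
  have S: "S \<subseteq> {..<l}" by (auto simp: S_def)
  then have fS: "finite S" using finite_subset by blast
  \<comment> \<open>Markov's inequality: users outside \<open>S\<close> have dimension above
    \<open>d = 2 * n / l\<close>, so they number at most \<open>l / 2\<close>.\<close>
  have cS: "real l \<le> 2 * card S"
  proof -
    have "d * card ({..<l} - S) = (\<Sum>i\<in>{..<l} - S. d)" by simp
    also have "\<dots> \<le> (\<Sum>i\<in>{..<l} - S. real (card (B i)))" by (intro sum_mono) (auto simp: S_def)
    also have "\<dots> \<le> (\<Sum>i<l. real (card (B i)))" by (intro sum_mono2) auto
    also have "\<dots> \<le> n" using sum_card by (simp flip: of_nat_sum)
    finally have "2 * real (card ({..<l} - S)) \<le> l"
      using assms(7,8) by (simp add: d_def field_simps)
    moreover have "card ({..<l} - S) = l - card S" "card S \<le> l"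
      using S fS card_mono[OF _ S] by (auto simp: card_Diff_subset)
    ultimately show ?thesis by linarith
  qed
  then have "S \<noteq> {}" using assms(7) by auto
  obtain i W where i: "i \<in> S" and le: "M * (1 - sqrt (\<epsilon> * (1 + 1 / (\<alpha> * card S))))
      \<le> (\<Sum>w=1..M. success_prob N0 n l f g (W(i := w)))" and W: "W \<in> messages l M"
    using exists_reliable_user[OF code assms(3) \<alpha> S \<open>S \<noteq> {}\<close>] by metis
  have il: "i < l" and di: "real (card (B i)) \<le> d" using i by (auto simp: S_def)
  let ?K = "exp (c * (E + 2 * real (card (B i)))) * (2 / (1 - exp (- c))) ^ card (B i)"
  have "1 / (\<alpha> * card S) \<le> 2 / (\<alpha> * l)"
    using cS \<alpha> assms(7) by (simp add: divide_simps)
  then have "\<epsilon> * (1 + 1 / (\<alpha> * card S)) \<le> 1 / 16"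
    using \<epsilon> \<epsilon>0 mult_left_mono[of "1 + 1 / (\<alpha> * card S)" "1 + 2 / (\<alpha> * l)" \<epsilon>] by linarith
  then have "sqrt (\<epsilon> * (1 + 1 / (\<alpha> * card S))) \<le> sqrt ((1 / 4)^2)"
    by (intro real_sqrt_le_mono) (simp add: power2_eq_square)
  then have "M * (3 / 4) \<le> M * (1 - sqrt (\<epsilon> * (1 + 1 / (\<alpha> * card S))))"
    by (intro mult_left_mono) auto
  also note le
  also have "(\<Sum>w=1..M. success_prob N0 n l f g (W(i := w)))
      = (\<Sum>w=1..M. shift_prob N0 n (\<lambda>k. (codeword l f W k - f i (W i) k) + f i w k) (decoding_region n g (W(i := w))))"
    unfolding success_prob_def codeword_fun_upd[OF il] by (simp add: algebra_simps)
  also have "\<dots> \<le> card {1..M} / 4 + exp (2 * real (card (B i)) / N0) * ?K"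
    using assms M en il span
    by (intro sum_success_low_dim_le disjoint_decoding_regions inj_on_fun_upd decoding_region_sets[OF g] B) auto
  \<comment> \<open>Reliability \<open>3/4\<close> minus the \<open>1/4\<close> lost in Young's
    inequality leaves \<open>M / 2\<close> on the left.\<close>
  finally have "M \<le> 2 * (exp (2 * real (card (B i)) / N0) * ?K)" by (simp add: mult_ac)
  then have "ln M \<le> ln (2 * (exp (2 * real (card (B i)) / N0) * ?K))"
    using M assms(4) by (subst ln_le_cancel_iff) auto
  also have "\<dots> = ln 2 + 2 * real (card (B i)) / N0 + c * (E + 2 * real (card (B i)))
      + card (B i) * ln (2 / (1 - exp (- c)))"
    using assms(4) by (simp add: ln_mult ln_realpow del: ln_div)
  also have "\<dots> \<le> ln 2 + 2 * d / N0 + c * (E + 2 * d) + d * ln (2 / (1 - exp (- c)))"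
  proof -
    have "0 \<le> ln (2 / (1 - exp (- c)))"
      using assms(4) order_trans[OF _ exp_ge_zero, of "- 1" "- c"] by (intro ln_ge_zero) (simp add: pos_le_divide_eq)
    then show ?thesis
      using di assms(3,4)
      by (intro add_mono mult_left_mono mult_right_mono divide_right_mono) auto
  qed
  finally show ?thesis .
qed

subsection \<open>Asymptotic converse\<close>

text \<open>A rate above capacity keeps the right-hand side of \<open>code_rate_bound\<close> below
  a constant \<open>q < 1\<close> for every admissible \<open>M\<close>, while achievability allows
  an \<epsilon> that pushes the left-hand side above \<open>q\<close>.\<close>

lemma achievable_le_capacity:
  fixes \<alpha> :: "nat \<Rightarrow> real"
  assumes "N0 > 0" "b > 1" and \<alpha>: "\<And>n. 0 \<le> \<alpha> n \<and> \<alpha> n \<le> 1"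
    and c: "c > 0" "eventually (\<lambda>n. c \<le> \<alpha> n * real (l n)) sequentially"
    and ach: "achievable_orth b N0 l \<alpha> R"
  shows "R \<le> log b (exp 1) / N0"
proof (rule ccontr)
  assume neg: "\<not> ?thesis"
  have lb: "ln b > 0" using assms by simp
  \<comment> \<open>\<open>r\<close> is the ratio of \<open>R\<close> to the claimed capacity. The
    rate \<open>R - \<delta>\<close> then has ratio \<open>1 + 2 * \<eta>\<close>, and the converse
    is used at the intermediate value \<open>p = 1 + \<eta>\<close>.\<close>
  define r where "r = R * ln b * N0"
  have r: "r > 1" using neg lb assms(1) by (simp add: r_def log_def field_simps)
  define \<eta> where "\<eta> = (r - 1) / 4"
  define \<delta> where "\<delta> = (r - 1) / (2 * ln b * N0)"
  define \<kappa> where "\<kappa> = 1 / (1 + \<eta>) - 1 / (1 + 2 * \<eta>)"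
  define q where "q = exp (- \<eta> * \<kappa> * ln 2)"
  have \<eta>: "\<eta> > 0" and \<delta>: "\<delta> > 0" using r lb assms(1) by (auto simp: \<eta>_def \<delta>_def)
  then have \<kappa>: "\<kappa> > 0" by (simp add: \<kappa>_def frac_less2)
  have q: "0 < q" "q < 1" using \<eta> \<kappa> by (auto simp: q_def)
  define \<epsilon> where "\<epsilon> = (1 - q)^2 / (2 * (1 + 1 / c))"
  have q2: "(1 - q)^2 < 1" "0 < (1 - q)^2" using q by (auto simp: power_less_one_iff)
  have c1: "1 + 1 / c > 0" using c by (simp add: add_pos_pos)
  then have \<epsilon>: "0 < \<epsilon>" unfolding \<epsilon>_def using q2 by (intro divide_pos_pos mult_pos_pos) auto
  have \<epsilon>c: "\<epsilon> * (1 + 1 / c) = (1 - q)^2 / 2" 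
  proof -
    have "x / (2 * s) * s = x / 2" if "s > 0" for x s :: real using that by (simp add: field_simps)
    then show ?thesis unfolding \<epsilon>_def using c1 by blast
  qed
  have "\<epsilon> \<le> \<epsilon> * (1 + 1 / c)" using \<epsilon> c by simp
  then have "\<epsilon> < 1" using \<epsilon>c q2 by simp
  then have "eps_achievable_orth b N0 l \<alpha> \<epsilon> R" using ach \<epsilon> by (simp add: achievable_orth_def)
  then obtain n0 where n0: "\<And>n. n \<ge> n0 \<Longrightarrow> \<exists>M E f g.
        is_code N0 n (l n) (\<alpha> n) M E \<epsilon> f g \<and> orthogonal_access n (l n) M f \<and>
        0 < E \<and> log b (real M) / E > R - \<delta>"
    using \<delta> unfolding eps_achievable_orth_def by blast
  obtain n where n: "n \<ge> n0" "c \<le> \<alpha> n * real (l n)"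
    using eventually_conj[OF c(2) eventually_ge_at_top[of n0]] eventually_happens'[OF sequentially_bot] by blast
  obtain M E f g where code: "is_code N0 n (l n) (\<alpha> n) M E \<epsilon> f g" and E: "0 < E"
    and rate: "log b (real M) / E > R - \<delta>"
    using n0[OF n(1)] by blast
  have M: "1 \<le> M" using code by (simp add: is_code_def)
  have "0 < \<alpha> n * real (l n)" using n(2) c(1) by linarith
  then have \<alpha>n: "0 < \<alpha> n" and ln: "0 < l n" using \<alpha>[of n] by (auto simp: zero_less_mult_iff)
  have "(R - \<delta>) * E * ln b < ln M"
    using rate E lb by (simp add: log_def field_simps)
  moreover have "(R - \<delta>) * ln b = (1 + 2 * \<eta>) / N0"
    using lb assms(1) by (simp add: \<delta>_def \<eta>_def r_def field_simps)
  ultimately have lnM: "(1 + 2 * \<eta>) * (E / N0) < ln M" by (simp add: mult_ac)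
  then have "ln M > 0" using \<eta> E assms(1) by (smt (verit) divide_pos_pos mult_pos_pos)
  \<comment> \<open>A positive rate excludes \<open>M = 1\<close>, so \<open>ln M\<close> is at
    least \<open>ln 2\<close> even if \<open>E\<close> is tiny.\<close>
  then have "M \<noteq> 1" by auto
  then have M2: "ln 2 \<le> ln M" using M by simp
  have EN: "E / N0 \<le> ln M / (1 + 2 * \<eta>)" using lnM \<eta> by (simp add: pos_le_divide_eq mult.commute)
  have "1 - sqrt (\<epsilon> * (1 + 1 / (\<alpha> n * l n))) \<le> exp (((1 + \<eta>) - 1) * (E / N0 - ln M / (1 + \<eta>)))"
    using code_rate_bound[OF code assms(1) \<alpha>n _ ln, of "1 + \<eta>"] \<alpha> \<eta> by auto
  also have "((1 + \<eta>) - 1) * (E / N0 - ln M / (1 + \<eta>)) \<le> \<eta> * (ln M / (1 + 2 * \<eta>) - ln M / (1 + \<eta>))"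
    using EN \<eta> by simp
  also have "\<dots> = - \<eta> * \<kappa> * ln M" by (simp add: \<kappa>_def algebra_simps)
  also have "\<dots> \<le> - \<eta> * \<kappa> * ln 2" using M2 \<eta> \<kappa> by simp
  finally have "1 - q \<le> sqrt (\<epsilon> * (1 + 1 / (\<alpha> n * l n)))" by (simp add: q_def)
  also have "\<dots> \<le> sqrt (\<epsilon> * (1 + 1 / c))"
    using n(2) c(1) \<epsilon> by (intro real_sqrt_le_mono mult_left_mono add_left_mono divide_left_mono) auto
  also have "\<dots> < sqrt ((1 - q)^2)" unfolding \<epsilon>c using q2 by (intro real_sqrt_less_mono) linarith
  finally show False using q by simp
qed

text \<open>The energy bound gives \<open>E\<close> of order at least \<open>ln n\<close>, whereas
  half of the users have dimension \<open>o(ln n) = o(E)\<close>. The low-dimensional bound then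
  makes \<open>ln M\<close> at most half of what a positive rate requires, up to the constant
  \<open>ln 2\<close>.\<close>

lemma no_positive_rate:
  fixes \<alpha> :: "nat \<Rightarrow> real"
  assumes "N0 > 0" "b > 1" and \<alpha>: "\<And>n. 0 \<le> \<alpha> n \<and> \<alpha> n \<le> 1"
    and c: "c > 0" "eventually (\<lambda>n. c \<le> \<alpha> n * real (l n)) sequentially"
    and l: "(\<lambda>n. real (l n)) \<in> \<omega>(\<lambda>n. real n / log b (real n))"
    and ach: "achievable_orth b N0 l \<alpha> R"
  shows "R \<le> 0"
proof (rule ccontr)
  assume "\<not> ?thesis"
  then have R: "R > 0" by simp
  have lb: "ln b > 0" using assms by simp
  \<comment> \<open>\<open>\<rho>\<close> is half the rate in nats. \<open>t\<close> and
    \<open>K\<close> are chosen so that the energy term and the dimension term \<open>d * C\<close>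
    are each at most a quarter of \<open>\<rho> * E\<close>.\<close>
  define \<rho> where "\<rho> = R / 2 * ln b"
  define t where "t = \<rho> / 4"
  define C where "C = 2 / N0 + 2 * t + ln (2 / (1 - exp (- t)))"
  define K where "K = 128 * C / (ln b * N0 * \<rho>)"
  define \<epsilon> where "\<epsilon> = 1 / (16 * (1 + 2 / c))"
  have \<rho>: "\<rho> > 0" and t: "t > 0" using R lb by (auto simp: \<rho>_def t_def)
  have "ln (2 / (1 - exp (- t))) \<ge> 0"
    using t order_trans[OF _ exp_ge_zero, of "- 1" "- t"] by (intro ln_ge_zero) (simp add: pos_le_divide_eq)
  then have C: "C > 0" using assms(1) t by (simp add: C_def add_pos_pos add_pos_nonneg)
  then have K: "K > 0" using lb assms(1) \<rho> by (simp add: K_def)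
  have \<epsilon>: "0 < \<epsilon>" "\<epsilon> \<le> 1 / 16" and \<epsilon>c: "\<epsilon> * (1 + 2 / c) = 1 / 16"
  proof -
    define s where "s = 1 + 2 / c"
    have "s > 1" using c by (simp add: s_def)
    then show "0 < \<epsilon>" "\<epsilon> \<le> 1 / 16" "\<epsilon> * (1 + 2 / c) = 1 / 16"
      unfolding \<epsilon>_def s_def[symmetric] by (auto simp: field_simps)
  qed
  then have "eps_achievable_orth b N0 l \<alpha> \<epsilon> R" using ach by (simp add: achievable_orth_def)
  moreover have "R / 2 > 0" using R by simp
  ultimately obtain n0 where n0: "\<And>n. n \<ge> n0 \<Longrightarrow> \<exists>M E f g.
        is_code N0 n (l n) (\<alpha> n) M E \<epsilon> f g \<and> orthogonal_access n (l n) M f \<and>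
        0 < E \<and> log b (real M) / E > R - R / 2"
    unfolding eps_achievable_orth_def by blast
  have lK: "eventually (\<lambda>n. norm (real (l n)) \<ge> K' * norm (real n / log b (real n))) sequentially" if "K' > 0" for K'
    using landau_omega.smallD[OF l that] .
  \<comment> \<open>The number of users is at least of order \<open>n / log n\<close>, hence
    eventually \<open>64 * sqrt n\<close>; the factor 64 cancels the constant from the energy
    bound.\<close>
  have "eventually (\<lambda>n. real n / (ln (real n) / ln b) \<ge> 64 * sqrt (real n)) sequentially"
    using lb by real_asymp
  moreover have "eventually (\<lambda>n. ln (real n) > 32 * ln 2 / (\<rho> * N0)) sequentially"
    using \<rho> assms(1) by real_asymp
  ultimately have "eventually (\<lambda>n. n \<ge> n0 \<and> n \<ge> 2 \<and> c \<le> \<alpha> n * real (l n)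
      \<and> norm (real (l n)) \<ge> K * norm (real n / log b (real n))
      \<and> norm (real (l n)) \<ge> 1 * norm (real n / log b (real n))
      \<and> real n / (ln (real n) / ln b) \<ge> 64 * sqrt (real n)
      \<and> ln (real n) > 32 * ln 2 / (\<rho> * N0)) sequentially"
    using c(2) lK[OF K] lK[of 1] eventually_ge_at_top[of n0] eventually_ge_at_top[of "2::nat"]
    by (auto simp: eventually_conj_iff)
  then obtain n where n: "n \<ge> n0" "n \<ge> 2" "c \<le> \<alpha> n * real (l n)"
    and l1: "real (l n) \<ge> K * \<bar>real n / log b (real n)\<bar>" and l2: "real (l n) \<ge> \<bar>real n / log b (real n)\<bar>"
    and n64: "real n / (ln (real n) / ln b) \<ge> 64 * sqrt (real n)"
    and nlarge: "ln (real n) > 32 * ln 2 / (\<rho> * N0)"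
    using eventually_happens'[OF sequentially_bot] by force
  have lnn: "ln (real n) > 0" using n(2) by simp
  have logn: "real n / log b (real n) = real n * ln b / ln (real n)" by (simp add: log_def)
  obtain M E f g where code: "is_code N0 n (l n) (\<alpha> n) M E \<epsilon> f g"
    and orth: "orthogonal_access n (l n) M f" and E: "0 < E"
    and rate: "log b (real M) / E > R - R / 2"
    using n0[OF n(1)] by blast
  have M: "1 \<le> M" using code by (simp add: is_code_def)
  have pos: "0 < \<alpha> n * real (l n)" using n(3) c(1) by linarith
  then have \<alpha>n: "0 < \<alpha> n" and ln: "0 < l n" using \<alpha>[of n] by (auto simp: zero_less_mult_iff)
  have \<alpha>1: "\<alpha> n \<le> 1" using \<alpha> by simp
  have lnM: "\<rho> * E < ln M"
    using rate E lb by (simp add: \<rho>_def log_def field_simps)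
  then have "ln M > 0" using \<rho> E by (smt (verit) mult_pos_pos)
  then have "M \<noteq> 1" by auto
  then have M2: "2 \<le> M" using M by simp
  have le16: "\<epsilon> * (1 + s / (\<alpha> n * l n)) \<le> 1 / 16" if "0 \<le> s" "s \<le> 2" for s
  proof -
    have "s / (\<alpha> n * l n) \<le> 2 / c" using n(3) c(1) that by (intro frac_le) auto
    then have "\<epsilon> * (1 + s / (\<alpha> n * l n)) \<le> \<epsilon> * (1 + 2 / c)"
      using \<epsilon> by (intro mult_left_mono) auto
    then show ?thesis unfolding \<epsilon>c .
  qed
  have "1 / 2 \<le> \<epsilon> + sqrt (exp (8 * E / N0) / l n) + sqrt (\<epsilon> * (1 + 1 / (\<alpha> n * l n)))"
    by (rule code_energy_bound[OF code orth assms(1) \<alpha>n \<alpha>1 ln M2])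
  moreover have "sqrt (\<epsilon> * (1 + 1 / (\<alpha> n * l n))) \<le> sqrt ((1/4)^2)"
    using le16[of 1] by (intro real_sqrt_le_mono) (simp add: power2_eq_square)
  \<comment> \<open>\<open>1/2 - 1/16 - 1/4\<close> exceeds \<open>1/8\<close>.\<close>
  ultimately have "sqrt ((1/8)^2) \<le> sqrt (exp (8 * E / N0) / l n)" using \<epsilon> by simp
  then have "1 / 64 \<le> exp (8 * E / N0) / l n" by (simp add: power2_eq_square)
  then have "l n / 64 \<le> exp (8 * E / N0)" using ln by (simp add: field_simps)
  moreover have "sqrt (real n) \<le> l n / 64"
  proof -
    have "64 * sqrt (real n) \<le> \<bar>real n / log b (real n)\<bar>"
      using n64 abs_ge_self[of "real n / log b (real n)"] unfolding log_def by linarith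
    then show ?thesis using l2 by simp
  qed
  ultimately have "ln (sqrt (real n)) \<le> ln (exp (8 * E / N0))"
    using n(2) by (subst ln_le_cancel_iff) auto
  then have En: "ln (real n) \<le> 16 / N0 * E" using n(2) by (simp add: ln_sqrt)
  define d where "d = 2 * real n / real (l n)"
  have d: "d \<le> 2 * ln (real n) / (K * ln b)"
  proof -
    have "K * (real n * ln b / ln (real n)) \<le> real (l n)" using l1 lnn lb unfolding logn by simp
    then have "K * real n * ln b \<le> l n * ln (real n)" using lnn by (simp add: field_simps)
    then show ?thesis using ln lb K by (simp add: d_def field_simps)
  qed
  have "ln M \<le> ln 2 + 2 * d / N0 + t * (E + 2 * d) + d * ln (2 / (1 - exp (- t)))"
    unfolding d_def using le16[of 2] n(2)
    by (intro code_low_dim_bound[OF code orth assms(1) t \<alpha>n \<alpha>1 ln]) auto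
  also have "\<dots> = ln 2 + t * E + d * C" by (simp add: C_def algebra_simps)
  also have "d * C \<le> 2 * (16 / N0 * E) / (K * ln b) * C"
  proof -
    have "2 * ln (real n) / (K * ln b) \<le> 2 * (16 / N0 * E) / (K * ln b)"
      using En K lb by (intro divide_right_mono) auto
    then show ?thesis using d C by (intro mult_right_mono) auto
  qed
  also have "\<dots> = \<rho> / 4 * E" using C lb assms(1) \<rho> by (simp add: K_def field_simps)
  \<comment> \<open>This keeps \<open>E\<close> bounded, although the energy bound makes it at least
    \<open>N0 / 16 * ln n\<close>.\<close>
  finally have "\<rho> * E / 2 \<le> ln 2" using lnM by (simp add: t_def mult.commute[of E])
  moreover have "\<rho> * N0 * ln (real n) \<le> 16 * (\<rho> * E)"
    using mult_left_mono[OF En, of "\<rho> * N0"] \<rho> assms(1) by (simp add: field_simps)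
  moreover have "32 * ln 2 < \<rho> * N0 * ln (real n)"
    using nlarge \<rho> assms(1) by (simp add: field_simps)
  ultimately show False by simp
qed

subsection \<open>Achievability\<close>

text \<open>The subgaussian moment bound for a random sign, with exponent \<open>x^2\<close> in
  place of the sharp \<open>x^2 / 2\<close>.\<close>

lemma cosh_bound:
  assumes "0 \<le> x" "x \<le> (1::real)"
  shows "exp x + exp (- x) \<le> 2 * exp (x^2)"
proof -
  have "exp x \<le> 1 + x + x^2" using assms by (rule exp_bound)
  moreover have "exp (- x) \<le> 1 - x + x^2"
  proof -
    have "exp (- x) = 1 / exp x" by (simp add: exp_minus field_simps)
    also have "\<dots> \<le> 1 / (1 + x)" using assms by (intro divide_left_mono exp_ge_add_one_self) auto
    also have "\<dots> \<le> 1 - x + x^2"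
      using assms by (simp add: field_simps power2_eq_square)
    finally show ?thesis .
  qed
  moreover have "1 + x^2 \<le> exp (x^2)" by (rule exp_ge_add_one_self)
  ultimately show ?thesis by linarith
qed

abbreviation sign_vectors :: "nat \<Rightarrow> (nat \<Rightarrow> real) set" where
  "sign_vectors d \<equiv> \<Pi>\<^sub>E k\<in>{..<d}. {-1, 1}"

lemma inner_sign_vector: "s \<in> sign_vectors d \<Longrightarrow> inner_n d s s = d"
proof -
  assume s: "s \<in> sign_vectors d"
  have "s k * s k = 1" if "k < d" for k using PiE_mem[OF s, of k] that by auto
  then show ?thesis by (simp add: inner_n_def)
qed

text \<open>Chernoff bound for uniformly random signs, written as a count: the exponential moment
  factors over the coordinates.\<close>

lemma card_correlated_sign_vectors:
  assumes "0 < \<eta>" "\<eta> \<le> 1" and s: "s \<in> sign_vectors d"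
  shows "card {v \<in> sign_vectors d. \<eta> * d \<le> inner_n d v s} \<le> 2 ^ d * exp (- (\<eta>^2 * d / 4))"
proof -
  let ?V = "sign_vectors d"
  \<comment> \<open>The minimiser of \<open>t^2 - t * \<eta>\<close>, with minimum
    \<open>- \<eta>^2 / 4\<close>.\<close>
  define t where "t = \<eta> / 2"
  have cosh: "exp t + exp (- t) \<le> 2 * exp (t^2)"
    by (rule cosh_bound) (use assms in \<open>simp_all add: t_def\<close>)
  have fin: "finite ?V" by (intro finite_PiE) auto
  have "real (card {v \<in> ?V. \<eta> * d \<le> inner_n d v s}) = (\<Sum>v\<in>{v \<in> ?V. \<eta> * d \<le> inner_n d v s}. 1)" by simp
  also have "\<dots> \<le> (\<Sum>v\<in>{v \<in> ?V. \<eta> * d \<le> inner_n d v s}. exp (t * (inner_n d v s - \<eta> * d)))"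
    using assms by (intro sum_mono) (auto simp: t_def)
  also have "\<dots> \<le> (\<Sum>v\<in>?V. exp (t * (inner_n d v s - \<eta> * d)))"
    by (intro sum_mono2 fin) auto
  also have "\<dots> = (\<Sum>v\<in>?V. exp (- (t * \<eta> * d)) * (\<Prod>k<d. exp (t * (v k * s k))))"
    by (intro sum.cong refl) 
       (simp add: inner_n_def exp_sum[symmetric] sum_distrib_left[symmetric] exp_add[symmetric] right_diff_distrib)
  also have "\<dots> = exp (- (t * \<eta> * d)) * (\<Prod>k<d. \<Sum>x\<in>{-1, 1}. exp (t * (x * s k)))"
    by (subst prod_sum_PiE) (auto simp: sum_distrib_left)
  also have "(\<Prod>k<d. \<Sum>x\<in>{-1, 1}. exp (t * (x * s k))) \<le> (\<Prod>k<d. 2 * exp (t^2))"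
  proof (rule prod_mono, intro conjI)
    fix k assume "k \<in> {..<d}"
    then have "s k = -1 \<or> s k = 1" using PiE_mem[OF s, of k] by auto
    then show "(\<Sum>x\<in>{-1, 1}. exp (t * (x * s k))) \<le> 2 * exp (t^2)"
      using cosh by (auto simp: add.commute)
  qed (auto intro!: sum_nonneg)
  also have "(\<Prod>k<d. 2 * exp (t^2)) = 2 ^ d * exp (t^2 * d)"
    by (simp add: power_mult_distrib exp_of_nat2_mult)
  also have "exp (- (t * \<eta> * d)) * (2 ^ d * exp (t^2 * d)) = 2 ^ d * exp (- (\<eta>^2 * d / 4))"
    by (simp add: t_def power2_eq_square flip: exp_add) 
  finally show ?thesis by simp
qed

text \<open>Gilbert-Varshamov argument: the caps of highly correlated vectors around a code of
  maximal size cover all sign vectors, and each cap is exponentially small.\<close>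

lemma exists_sign_code:
  assumes "0 < \<eta>" "\<eta> \<le> 1"
  obtains C where "C \<subseteq> sign_vectors d" "finite C" "exp (\<eta>^2 * d / 4) \<le> card C"
    "\<And>s t. s \<in> C \<Longrightarrow> t \<in> C \<Longrightarrow> s \<noteq> t \<Longrightarrow> inner_n d s t \<le> \<eta> * d"
proof -
  let ?V = "sign_vectors d"
  have fin: "finite ?V" by (intro finite_PiE) auto
  \<comment> \<open>The inequality is strict so that its negation is exactly membership in a
    cap.\<close>
  define P where "P C \<longleftrightarrow> C \<subseteq> ?V \<and> (\<forall>s\<in>C. \<forall>t\<in>C. s \<noteq> t \<longrightarrow> inner_n d s t < \<eta> * d)" for C
  have "P {}" by (simp add: P_def)
  moreover have "\<forall>C. P C \<longrightarrow> card C < Suc (card ?V)" using card_mono[OF fin] by (auto simp: P_def less_Suc_eq_le)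
  ultimately have "\<exists>C. P C \<and> (\<forall>C'. P C' \<longrightarrow> card C' \<le> card C)"
    by (rule ex_has_greatest_nat[of P "{}" card "Suc (card ?V)"])
  then obtain C where C: "P C" and max: "\<And>C'. P C' \<Longrightarrow> card C' \<le> card C"
    by (elim exE conjE) simp
  have sub: "C \<subseteq> ?V" using C by (simp add: P_def)
  have finC: "finite C" by (rule finite_subset[OF sub fin])
  have cover: "?V \<subseteq> (\<Union>s\<in>C. {v \<in> ?V. \<eta> * d \<le> inner_n d v s})"
  proof
    fix v assume v: "v \<in> ?V"
    have "\<exists>s\<in>C. \<eta> * d \<le> inner_n d v s"
    proof (cases "v \<in> C")
      case True
      then show ?thesis using inner_sign_vector[OF v] assms by (intro bexI[of _ v]) (auto simp: mult_left_le_one_le)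
    next
      case False
      then have "\<not> P (insert v C)" using max[of "insert v C"] finC by auto
      then obtain s where "s \<in> C" "\<not> inner_n d v s < \<eta> * d \<or> \<not> inner_n d s v < \<eta> * d"
        using C v unfolding P_def by auto
      then show ?thesis by (auto simp: inner_n_commute[of d s v] not_less)
    qed
    then show "v \<in> (\<Union>s\<in>C. {v \<in> ?V. \<eta> * d \<le> inner_n d v s})" using v by auto
  qed
  have "2 ^ d = real (card ?V)" by (simp add: card_PiE)
  also have "\<dots> \<le> card (\<Union>s\<in>C. {v \<in> ?V. \<eta> * d \<le> inner_n d v s})"
    using cover fin finC by (intro of_nat_mono card_mono) auto
  also have "\<dots> \<le> (\<Sum>s\<in>C. real (card {v \<in> ?V. \<eta> * d \<le> inner_n d v s}))"
    unfolding of_nat_sum[symmetric] of_nat_le_iff by (rule card_UN_le[OF finC])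
  also have "\<dots> \<le> (\<Sum>s\<in>C. 2 ^ d * exp (- (\<eta>^2 * d / 4)))"
    using sub assms by (intro sum_mono card_correlated_sign_vectors) auto
  finally have "1 \<le> card C * exp (- (\<eta>^2 * d / 4))" by simp
  then have "exp (\<eta>^2 * d / 4) \<le> card C" by (simp add: exp_minus field_simps)
  then show ?thesis using that[OF sub finC] C by (auto simp: P_def less_imp_le)
qed

section \<open>Gaussian tails and threshold decoding\<close>

text \<open>Markov's inequality for the likelihood of the multiple \<open>a / E\<close> of
  \<open>x\<close>, which has mean one and is at least \<open>exp (a^2 / (N0 * E))\<close> on the
  event.\<close>

lemma noise_tail_le:
  assumes "N0 > 0" and x: "inner_n n x x = E" "E > 0" and "a \<ge> 0"
  shows "measure (noise_measure n N0) {z \<in> space (noise_measure n N0). a \<le> inner_n n z x}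
    \<le> exp (- (a^2 / (N0 * E)))"
proof -
  let ?\<nu> = "noise_measure n N0"
  interpret prob_space ?\<nu> by (rule prob_space_noise_measure) fact
  define y where "y = (\<lambda>k. a / E * x k)"
  let ?A = "{z \<in> space ?\<nu>. exp (a^2 / (N0 * E)) \<le> likelihood N0 n y z}"
  have [measurable]: "likelihood N0 n y \<in> borel_measurable ?\<nu>"
    by (simp add: measurable_noise_measure)
  have A: "?A \<in> events" by measurable
  have "prob {z \<in> space ?\<nu>. a \<le> inner_n n z x} \<le> prob ?A"
  proof (intro finite_measure_mono A, safe)
    fix z assume "a \<le> inner_n n z x"
    then have "a * a \<le> a * inner_n n z x" using assms by (intro mult_left_mono) auto
    then have "a^2 / E \<le> 2 * (a / E * inner_n n z x) - a / E * (a / E * E)"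
      using x by (simp add: field_simps power2_eq_square)
    then have "a^2 / E / N0 \<le> (2 * (a / E * inner_n n z x) - a / E * (a / E * E)) / N0"
      using assms(1) by (intro divide_right_mono) auto
    then show "exp (a^2 / (N0 * E)) \<le> likelihood N0 n y z"
      unfolding likelihood_def y_def inner_n_linear x by (simp add: mult.commute)
  qed
  also have "\<dots> \<le> (\<integral>z. likelihood N0 n y z \<partial>?\<nu>) / exp (a^2 / (N0 * E))"
    by (intro integral_Markov_inequality_measure[where A = "{}"] integrable_likelihood assms)
       (auto intro!: AE_I2 less_imp_le[OF likelihood_pos])
  also have "\<dots> = exp (- (a^2 / (N0 * E)))"
    using integral_likelihood[OF assms(1)] by (simp add: exp_minus field_simps)
  finally show ?thesis .
qed

text \<open>The two alternatives exclude each other and one of them always has a candidate, so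
  \<open>LEAST\<close> only breaks ties between several messages above the threshold.\<close>

definition threshold_decoder ::
  "nat \<Rightarrow> nat \<Rightarrow> nat \<Rightarrow> (nat \<Rightarrow> nat \<Rightarrow> nat \<Rightarrow> real) \<Rightarrow> real \<Rightarrow> (nat \<Rightarrow> real) \<Rightarrow> nat \<Rightarrow> nat" where
  "threshold_decoder n l M f \<theta> y = (\<lambda>i\<in>{..<l}. LEAST w.
     (w = 0 \<and> (\<forall>v\<in>{1..M}. inner_n n y (f i v) \<le> \<theta>)) \<or> (w \<in> {1..M} \<and> \<theta> < inner_n n y (f i w)))"

lemma threshold_decoder_eqI:
  assumes "W \<in> messages l M"
    and "\<And>i. i < l \<Longrightarrow> W i \<noteq> 0 \<Longrightarrow> \<theta> < inner_n n y (f i (W i))"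
    and "\<And>i v. i < l \<Longrightarrow> v \<in> {1..M} \<Longrightarrow> v \<noteq> W i \<Longrightarrow> inner_n n y (f i v) \<le> \<theta>"
  shows "threshold_decoder n l M f \<theta> y = W"
proof (rule extensionalityI[where A = "{..<l}"])
  show "W \<in> extensional {..<l}" using assms(1) by (simp add: PiE_def)
  fix i assume i: "i \<in> {..<l}"
  have Wi: "W i \<le> M" using PiE_mem[OF assms(1), of i] i by simp
  have "(LEAST w. (w = 0 \<and> (\<forall>v\<in>{1..M}. inner_n n y (f i v) \<le> \<theta>)) \<or> (w \<in> {1..M} \<and> \<theta> < inner_n n y (f i w))) = W i"
  proof (rule Least_equality)
    show "(W i = 0 \<and> (\<forall>v\<in>{1..M}. inner_n n y (f i v) \<le> \<theta>)) \<or> (W i \<in> {1..M} \<and> \<theta> < inner_n n y (f i (W i)))"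
      using assms(2,3)[of i] i Wi by (cases "W i = 0") auto
  next
    fix w assume w: "(w = 0 \<and> (\<forall>v\<in>{1..M}. inner_n n y (f i v) \<le> \<theta>)) \<or> (w \<in> {1..M} \<and> \<theta> < inner_n n y (f i w))"
    have "w = W i"
    proof (rule ccontr)
      assume neq: "w \<noteq> W i"
      from w show False
      proof (elim disjE conjE)
        assume "w = 0" and le: "\<forall>v\<in>{1..M}. inner_n n y (f i v) \<le> \<theta>"
        then have "W i \<in> {1..M}" using neq Wi by auto
        then show False using le assms(2)[of i] i by fastforce
      next
        assume "w \<in> {1..M}" "\<theta> < inner_n n y (f i w)"
        then show False using assms(3)[of i w] neq i by simp
      qed
    qed
    then show "W i \<le> w" by simp
  qed
  then show "threshold_decoder n l M f \<theta> y i = W i" using i by (simp add: threshold_decoder_def)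
qed (simp add: threshold_decoder_def)

lemma measurable_threshold_decoder:
  "threshold_decoder n l M f \<theta> \<in> (\<Pi>\<^sub>M k\<in>{..<n}. borel) \<rightarrow>\<^sub>M count_space (messages l M)"
  unfolding measurable_count_space_eq2[OF finite_messages]
proof (intro conjI ballI funcsetI)
  let ?Q = "\<lambda>i w y. (w = 0 \<and> (\<forall>v\<in>{1..M}. inner_n n y (f i v) \<le> \<theta>)) \<or> (w \<in> {1..M} \<and> \<theta> < inner_n n y (f i w))"
  have ex: "\<exists>w. ?Q i w y" for i y
    by (cases "\<forall>v\<in>{1..M}. inner_n n y (f i v) \<le> \<theta>") (auto simp: not_le)
  show "threshold_decoder n l M f \<theta> y \<in> messages l M" for y
    unfolding threshold_decoder_def
  proof (rule restrict_PiE_iff[THEN iffD2], intro ballI)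
    fix i
    show "(LEAST w. ?Q i w y) \<in> {0..M}" using LeastI_ex[OF ex[of y i]] by auto
  qed
  fix W assume W: "W \<in> messages l M"
  have eq: "threshold_decoder n l M f \<theta> y = W \<longleftrightarrow> (\<forall>i\<in>{..<l}. (LEAST w. ?Q i w y) = W i)" for y
    using W by (auto simp: threshold_decoder_def fun_eq_iff PiE_iff extensional_def)
  have "{y \<in> space (\<Pi>\<^sub>M k\<in>{..<n}. borel). \<forall>i\<in>{..<l}. (LEAST w. ?Q i w y) = W i} \<in> sets (\<Pi>\<^sub>M k\<in>{..<n}. borel)"
    by measurable
  then show "threshold_decoder n l M f \<theta> -` {W} \<inter> space (\<Pi>\<^sub>M k\<in>{..<n}. borel) \<in> sets (\<Pi>\<^sub>M k\<in>{..<n}. borel)"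
    by (simp add: eq vimage_def Int_def conj_commute)
qed

text \<open>By orthogonality the correlation of the output with a codeword of user \<open>i\<close>
  involves only this user's own signal and noise. Gaussian tails and a union bound over users and
  messages do the rest.\<close>

lemma threshold_success_prob:
  assumes "N0 > 0" "E > 0" "0 < \<kappa>" "\<kappa> \<le> 1" and W: "W \<in> messages l M"
    and zero: "\<And>i k. i < l \<Longrightarrow> k < n \<Longrightarrow> f i 0 k = 0"
    and energy: "\<And>i w. i < l \<Longrightarrow> w \<in> {1..M} \<Longrightarrow> inner_n n (f i w) (f i w) = E"
    and corr: "\<And>i v w. i < l \<Longrightarrow> v \<in> {1..M} \<Longrightarrow> w \<in> {1..M} \<Longrightarrow> v \<noteq> w
                 \<Longrightarrow> inner_n n (f i v) (f i w) \<le> \<kappa> / 2 * E"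
    and orth: "orthogonal_access n l M f"
  shows "1 - success_prob N0 n l f (threshold_decoder n l M f ((1 - \<kappa> / 2) * E)) W
    \<le> l * (exp (- (\<kappa>^2 * E / (4 * N0))) + M * exp (- ((1 - 2 * \<kappa>) * E / N0)))"
proof -
  let ?\<nu> = "noise_measure n N0" and ?\<theta> = "(1 - \<kappa> / 2) * E"
  let ?g = "threshold_decoder n l M f ?\<theta>"
  interpret prob_space ?\<nu> by (rule prob_space_noise_measure) fact
  define X where "X = codeword l f W"
  \<comment> \<open>The threshold lies \<open>\<kappa> / 2 * E\<close> below the signal of the sent
    codeword and at least \<open>(1 - \<kappa>) * E\<close> above that of any other; an inactive
    user has signal zero.\<close>
  define bad where "bad i v = {z \<in> space ?\<nu>. if v = W i then \<kappa> / 2 * E \<le> inner_n n z (\<lambda>k. (-1) * f i v k)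
      else (1 - \<kappa>) * E \<le> inner_n n z (f i v)}" for i v
  have Wi: "W i \<le> M" if "i < l" for i using PiE_mem[OF W, of i] that by simp
  have [measurable]: "(\<lambda>z. inner_n n z x) \<in> borel_measurable ?\<nu>" for x
    by (simp add: measurable_noise_measure)
  have bad: "bad i v \<in> events" for i v unfolding bad_def by (cases "v = W i") (simp; measurable)+
  have X: "inner_n n X (f i v) = inner_n n (f i (W i)) (f i v)" if i: "i < l" and v: "v \<le> M" for i v
  proof -
    have "inner_n n X (f i v) = (\<Sum>j<l. inner_n n (f j (W j)) (f i v))"
      unfolding X_def codeword_def[abs_def] by (rule inner_n_sum_left)
    also have "\<dots> = (\<Sum>j<l. if j = i then inner_n n (f i (W i)) (f i v) else 0)"
      using orth that Wi by (intro sum.cong) (auto simp: orthogonal_access_def)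
    finally show ?thesis using i by simp
  qed
  have good: "?g (\<lambda>k\<in>{..<n}. X k + z k) = W"
    if z: "z \<in> space ?\<nu>" and nb: "\<And>i v. i < l \<Longrightarrow> v \<in> {1..M} \<Longrightarrow> z \<notin> bad i v" for z
  proof (rule threshold_decoder_eqI[OF W])
    have split: "inner_n n (\<lambda>k\<in>{..<n}. X k + z k) x = inner_n n X x + inner_n n z x" for x
      unfolding inner_n_add_left[symmetric] by (intro inner_n_cong) auto
    show "?\<theta> < inner_n n (\<lambda>k\<in>{..<n}. X k + z k) (f i (W i))" if i: "i < l" "W i \<noteq> 0" for i
    proof -
      have v: "W i \<in> {1..M}" using i Wi by auto
      show ?thesis
        using nb[OF i(1) v] z X[of i "W i"] energy[OF i(1) v] v i
        by (simp add: bad_def inner_n_scale_right[of n z "- 1", simplified] split algebra_simps)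
    qed
    show "inner_n n (\<lambda>k\<in>{..<n}. X k + z k) (f i v) \<le> ?\<theta>" if i: "i < l" and v: "v \<in> {1..M}" "v \<noteq> W i" for i v
    proof -
      have "inner_n n (f i (W i)) (f i v) \<le> \<kappa> / 2 * E"
      proof (cases "W i = 0")
        case True
        then have "inner_n n (f i (W i)) (f i v) = 0" using zero[OF i] by (simp add: inner_n_def)
        then show ?thesis using assms by simp
      next
        case False
        then show ?thesis using corr[OF i _ v(1), of "W i"] v Wi[OF i] by auto
      qed
      then show ?thesis using nb[OF i v(1)] z X[OF i, of v] v by (simp add: bad_def split algebra_simps)
    qed
  qed
  have badle: "prob (bad i v) \<le> of_bool (v = W i) * exp (- (\<kappa>^2 * E / (4 * N0))) + exp (- ((1 - 2 * \<kappa>) * E / N0))"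
    if i: "i < l" and v: "v \<in> {1..M}" for i v
  proof (cases "v = W i")
    case True
    have "prob (bad i v) \<le> exp (- ((\<kappa> / 2 * E)^2 / (N0 * E)))"
      unfolding bad_def using True assms energy[OF i v]
      by (simp only: if_True refl) (intro noise_tail_le, auto simp: inner_n_scale_left[of n "- 1", simplified] inner_n_scale_right[of n _ "- 1", simplified])
    also have "(\<kappa> / 2 * E)^2 / (N0 * E) = \<kappa>^2 * E / (4 * N0)"
      using assms by (simp add: field_simps power2_eq_square)
    finally show ?thesis using True by (simp add: add_increasing2)
  next
    case False
    have "prob (bad i v) \<le> exp (- (((1 - \<kappa>) * E)^2 / (N0 * E)))"
      unfolding bad_def using False assms energy[OF i v]
      by (simp only: if_False) (intro noise_tail_le, auto)
    also have "((1 - \<kappa>) * E)^2 / (N0 * E) = (1 - \<kappa>)^2 * E / N0"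
      using assms by (simp add: field_simps power2_eq_square)
    \<comment> \<open>Dropping \<open>\<kappa>^2\<close> from the square makes the exponent linear,
      ready to be compared with the rate.\<close>
    also have "exp (- ((1 - \<kappa>)^2 * E / N0)) \<le> exp (- ((1 - 2 * \<kappa>) * E / N0))"
      using assms by (auto intro!: divide_right_mono mult_right_mono simp: power2_diff)
    finally show ?thesis using False by simp
  qed
  let ?G = "{z \<in> space ?\<nu>. (\<lambda>k\<in>{..<n}. X k + z k) \<in> decoding_region n ?g W}"
  have G: "?G \<in> events"
  proof -
    have "(\<lambda>z. \<lambda>k\<in>{..<n}. X k + z k) \<in> ?\<nu> \<rightarrow>\<^sub>M (\<Pi>\<^sub>M k\<in>{..<n}. (borel :: real measure))"
      by (simp add: measurable_noise_measure)
    from measurable_sets[OF this decoding_region_sets[OF measurable_threshold_decoder]]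
    show ?thesis by (simp add: vimage_def Int_def conj_commute)
  qed
  have "1 - success_prob N0 n l f ?g W = prob (space ?\<nu> - ?G)"
    unfolding success_prob_def shift_prob_def X_def[symmetric] by (rule prob_compl[OF G, symmetric])
  also have "\<dots> \<le> prob (\<Union>(i, v)\<in>{..<l} \<times> {1..M}. bad i v)"
  proof (intro finite_measure_mono)
    show "space ?\<nu> - ?G \<subseteq> (\<Union>(i, v)\<in>{..<l} \<times> {1..M}. bad i v)"
    proof
      fix z assume z: "z \<in> space ?\<nu> - ?G"
      then have "?g (\<lambda>k\<in>{..<n}. X k + z k) \<noteq> W" by (auto simp: decoding_region_def space_PiM)
      then show "z \<in> (\<Union>(i, v)\<in>{..<l} \<times> {1..M}. bad i v)" using good[of z] z by fastforce
    qed
  qed (use bad in \<open>auto intro!: sets.finite_UN\<close>)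
  also have "\<dots> \<le> (\<Sum>(i, v)\<in>{..<l} \<times> {1..M}. prob (bad i v))"
    using finite_measure_subadditive_finite[of "{..<l} \<times> {1..M}" "\<lambda>(i, v). bad i v"] bad
    by (auto simp: case_prod_unfold)
  also have "\<dots> = (\<Sum>i<l. \<Sum>v=1..M. prob (bad i v))" by (simp add: sum.cartesian_product)
  also have "\<dots> \<le> (\<Sum>i<l. exp (- (\<kappa>^2 * E / (4 * N0))) + M * exp (- ((1 - 2 * \<kappa>) * E / N0)))"
  proof (rule sum_mono)
    fix i assume i: "i \<in> {..<l}"
    have "(\<Sum>v=1..M. prob (bad i v))
        \<le> (\<Sum>v=1..M. of_bool (v = W i) * exp (- (\<kappa>^2 * E / (4 * N0))) + exp (- ((1 - 2 * \<kappa>) * E / N0)))"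
      using i by (intro sum_mono badle) auto
    also have "\<dots> = (\<Sum>v=1..M. of_bool (v = W i)) * exp (- (\<kappa>^2 * E / (4 * N0))) + M * exp (- ((1 - 2 * \<kappa>) * E / N0))"
      by (simp only: sum.distrib sum_distrib_right) simp
    also have "(\<Sum>v=1..M. of_bool (v = W i)) \<le> (1::real)" by (simp add: of_bool_def)
    finally show "(\<Sum>v=1..M. prob (bad i v)) \<le> exp (- (\<kappa>^2 * E / (4 * N0))) + M * exp (- ((1 - 2 * \<kappa>) * E / N0))"
      by (simp add: mult_right_mono)
  qed
  finally show ?thesis by simp
qed

text \<open>Time division: all users share one sign code of length \<open>d\<close>, placed in
  disjoint blocks and scaled to energy \<open>E\<close>. Correlation \<open>\<kappa> / 2\<close>
  allows \<open>exp (\<kappa>^2 * d / 16)\<close> codewords.\<close>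

lemma exists_orthogonal_code:
  fixes N0 E \<kappa> \<alpha> \<epsilon> :: real and d l n M :: nat
  assumes "N0 > 0" "E > 0" "0 < \<kappa>" "\<kappa> \<le> 1" "0 \<le> \<alpha>" "\<alpha> \<le> 1" "1 \<le> M"
    and d: "d > 0" "l * d \<le> n" and M: "real M \<le> exp (\<kappa>^2 * d / 16)"
    and \<epsilon>: "l * (exp (- (\<kappa>^2 * E / (4 * N0))) + M * exp (- ((1 - 2 * \<kappa>) * E / N0))) \<le> \<epsilon>" "\<epsilon> < 1"
  shows "\<exists>f g. is_code N0 n l \<alpha> M E \<epsilon> f g \<and> orthogonal_access n l M f"
proof -
  obtain C where C: "C \<subseteq> sign_vectors d" "finite C" "exp ((\<kappa> / 2)^2 * d / 4) \<le> card C"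
    and corrC: "\<And>s t. s \<in> C \<Longrightarrow> t \<in> C \<Longrightarrow> s \<noteq> t \<Longrightarrow> inner_n d s t \<le> \<kappa> / 2 * d"
    using exists_sign_code[of "\<kappa> / 2" d] assms by auto
  have "card {1..M} \<le> card C" using M C(3) by (simp add: power_divide)
  then obtain s where s: "s ` {1..M} \<subseteq> C" "inj_on s {1..M}"
    using card_le_inj[of "{1..M}" C] C(2) by auto
  \<comment> \<open>\<open>k div d\<close> is the owner of channel use \<open>k\<close> and
    \<open>k mod d\<close> its position in the block; uses from \<open>l * d\<close> on stay
    silent.\<close>
  define f where "f i w k = (if w = 0 \<or> k div d \<noteq> i then 0 else sqrt (E / d) * s w (k mod d))" for i w k
  have inner: "inner_n n (f i v) (f i w) = E / d * inner_n d (s v) (s w)"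
    if i: "i < l" and v: "v \<in> {1..M}" "w \<in> {1..M}" for i v w
  proof -
    have sub: "(\<lambda>j. i * d + j) ` {..<d} \<subseteq> {..<n}"
    proof
      fix k assume "k \<in> (\<lambda>j. i * d + j) ` {..<d}"
      then have "k < (i + 1) * d" by auto
      also have "(i + 1) * d \<le> l * d" using i by (intro mult_right_mono) auto
      finally show "k \<in> {..<n}" using d by simp
    qed
    have "inner_n n (f i v) (f i w) = (\<Sum>k\<in>(\<lambda>j. i * d + j) ` {..<d}. f i v k * f i w k)"
      unfolding inner_n_def
    proof (rule sum.mono_neutral_right[OF _ sub], simp, intro ballI)
      fix k assume k: "k \<in> {..<n} - (\<lambda>j. i * d + j) ` {..<d}"
      have "k div d \<noteq> i"
      proof
        assume "k div d = i"
        then have "k = i * d + k mod d" by (metis div_mult_mod_eq)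
        moreover have "k mod d < d" using d by simp
        ultimately show False using k by blast
      qed
      then show "f i v k * f i w k = 0" by (simp add: f_def)
    qed
    also have "\<dots> = (\<Sum>j<d. f i v (i * d + j) * f i w (i * d + j))"
      by (subst sum.reindex) (auto simp: inj_on_def)
    also have "\<dots> = (\<Sum>j<d. E / d * (s v j * s w j))"
    proof (rule sum.cong)
      fix j assume "j \<in> {..<d}"
      then have "f i x (i * d + j) = sqrt (E / d) * s x j" if "x \<in> {1..M}" for x
        using that by (simp add: f_def)
      then show "f i v (i * d + j) * f i w (i * d + j) = E / d * (s v j * s w j)"
        using v assms(2) real_sqrt_mult_self[of "E / d"] by (simp add: mult_ac)
    qed simp
    finally show ?thesis by (simp add: inner_n_def sum_distrib_left)
  qed
  have energy: "inner_n n (f i w) (f i w) = E" if "i < l" "w \<in> {1..M}" for i w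
  proof -
    have "s w \<in> sign_vectors d" using s(1) C(1) that(2) by blast
    then show ?thesis using inner[OF that(1,2,2)] inner_sign_vector[of "s w" d] d by simp
  qed
  have corr: "inner_n n (f i v) (f i w) \<le> \<kappa> / 2 * E" if "i < l" "v \<in> {1..M}" "w \<in> {1..M}" "v \<noteq> w" for i v w
  proof -
    have "s v \<in> C" "s w \<in> C" using s(1) that(2,3) by blast+
    moreover have "s v \<noteq> s w" using inj_onD[OF s(2) _ that(2,3)] that(4) by blast
    ultimately have "E / d * inner_n d (s v) (s w) \<le> E / d * (\<kappa> / 2 * d)"
      using assms(2) by (intro mult_left_mono corrC) auto
    then show ?thesis using inner[OF that(1-3)] d by (simp add: mult.commute)
  qed
  have zero: "f i 0 k = 0" for i k by (simp add: f_def)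
  have orth: "orthogonal_access n l M f"
    unfolding orthogonal_access_def inner_n_def by (auto intro!: sum.neutral simp: f_def)
  let ?g = "threshold_decoder n l M f ((1 - \<kappa> / 2) * E)"
  note int = integrable_messages[OF assms(5-7)]
  have "error_prob N0 n l \<alpha> M f ?g \<le> \<epsilon>"
  proof -
    have "error_prob N0 n l \<alpha> M f ?g = measure_pmf.expectation (messages_pmf l M \<alpha>) (\<lambda>W. 1 - success_prob N0 n l f ?g W)"
      by (rule error_prob_eq[OF assms(5-7,1) measurable_threshold_decoder])
    also have "\<dots> \<le> measure_pmf.expectation (messages_pmf l M \<alpha>) (\<lambda>_. \<epsilon>)"
      unfolding expectation_messages[OF assms(5-7)]
    proof (intro sum_mono mult_left_mono)
      fix W assume "W \<in> messages l M"
      then show "1 - success_prob N0 n l f ?g W \<le> \<epsilon>"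
        using threshold_success_prob[OF assms(1-4) _ zero energy corr orth, of W] \<epsilon>(1) by linarith
    qed simp
    finally show ?thesis by simp
  qed
  moreover have "0 \<le> \<epsilon>" by (rule order_trans[OF _ \<epsilon>(1)]) simp
  moreover have "inner_n n (f i w) (f i w) \<le> E" if "i < l" "w \<le> M" for i w
  proof (cases "w = 0")
    case True
    then show ?thesis using zero assms(2) by (simp add: inner_n_def)
  next
    case False
    then show ?thesis using energy[OF that(1), of w] that by simp
  qed
  ultimately have "is_code N0 n l \<alpha> M E \<epsilon> f ?g"
    unfolding is_code_def using assms(7) \<epsilon>(2) zero measurable_threshold_decoder by auto
  with orth show ?thesis by blast
qed

text \<open>With energy of order \<open>ln n\<close> each user errs with probability at most
  \<open>2 / n^2\<close>, so even \<open>n\<close> users together err with probability at most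
  \<open>2 / n\<close>. Blocks much longer than \<open>ln n\<close> leave room for
  \<open>exp ((1 - 3 * \<kappa>) * E / N0)\<close> codewords.\<close>

lemma capacity_achievable:
  fixes \<alpha> :: "nat \<Rightarrow> real"
  assumes "N0 > 0" "b > 1" and \<alpha>: "\<And>n. 0 \<le> \<alpha> n \<and> \<alpha> n \<le> 1"
    and lpos: "eventually (\<lambda>n. 0 < l n) sequentially"
    and l: "(\<lambda>n. real (l n)) \<in> o(\<lambda>n. real n / log b (real n))"
  shows "achievable_orth b N0 l \<alpha> (log b (exp 1) / N0)"
  unfolding achievable_orth_def eps_achievable_orth_def
proof (intro allI impI)
  fix \<epsilon> \<delta> :: real assume \<epsilon>: "0 < \<epsilon> \<and> \<epsilon> < 1" and \<delta>: "0 < \<delta>"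
  have lb: "ln b > 0" using assms by simp
  \<comment> \<open>The rate loss is \<open>4 * \<kappa> / (N0 * ln b)\<close>; the divisor 5 makes
    it strictly less than \<open>\<delta>\<close>.\<close>
  define \<kappa> where "\<kappa> = min (1 / 4) (\<delta> * N0 * ln b / 5)"
  have \<kappa>: "0 < \<kappa>" "\<kappa> \<le> 1 / 4" "\<kappa> \<le> \<delta> * N0 * ln b / 5"
    using \<delta> assms(1) lb by (auto simp: \<kappa>_def)
  \<comment> \<open>With \<open>E = K * ln n\<close> the missed-detection exponent
    \<open>\<kappa>^2 * E / (4 * N0)\<close> equals \<open>2 * ln n\<close>.\<close>
  define K where "K = 8 * N0 / \<kappa>^2"
  have K: "K > 0" using assms(1) \<kappa> by (simp add: K_def)
  \<comment> \<open>A block length of \<open>c * ln n\<close> makes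
    \<open>\<kappa>^2 * d / 16\<close> at least \<open>E / N0\<close>, enough for the sign
    code.\<close>
  define c where "c = 16 * (K / N0) / \<kappa>^2"
  have c: "c > 0" using K assms(1) \<kappa> by (simp add: c_def)
  define t where "t = 1 / ((c + 1) * ln b)"
  have t: "t > 0" using c lb by (simp add: t_def)
  have "eventually (\<lambda>n. norm (real (l n)) \<le> t * norm (real n / log b (real n))) sequentially"
    using landau_o.smallD[OF l t] .
  moreover have "eventually (\<lambda>n. ln (real n) > ln 2 / (\<kappa> * K / N0)) sequentially"
    using \<kappa> K assms(1) by real_asymp
  moreover have "eventually (\<lambda>n. 2 / real n < \<epsilon>) sequentially"
    using \<epsilon> by real_asymp
  moreover have "eventually (\<lambda>n. ln (real n) > 1) sequentially"
    by real_asymp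
  ultimately have "eventually (\<lambda>n. \<exists>M E f g.
        is_code N0 n (l n) (\<alpha> n) M E \<epsilon> f g \<and> orthogonal_access n (l n) M f \<and>
        0 < E \<and> log b (real M) / E > log b (exp 1) / N0 - \<delta>) sequentially"
    using lpos
  proof eventually_elim
    case (elim n)
    have lnn: "ln (real n) > 1" using elim by simp
    then have n: "n > 1" by (cases "n = 0 \<or> n = 1") auto
    define L where "L = ln (real n)"
    have L: "L > 1" using lnn by (simp add: L_def)
    define d where "d = n div l n"
    define E where "E = K * L"
    define M where "M = nat \<lfloor>exp ((1 - 3 * \<kappa>) * E / N0)\<rfloor>"
    have E: "E > 0" using K L by (simp add: E_def)
    have "real n / log b (real n) = real n * ln b / L" by (simp add: log_def L_def)
    then have "real (l n) \<le> t * (real n * ln b / L)"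
      using elim(1) L lb by simp
    also have "\<dots> = real n / ((c + 1) * L)"
    proof -
      have "1 / (u * B) * (x * B / y) = x / (u * y)" if "B \<noteq> 0" for u B x y :: real
        using that by simp
      then show ?thesis unfolding t_def using lb by simp
    qed
    finally have "(c + 1) * L * real (l n) \<le> real n"
      using c L by (subst (asm) pos_le_divide_eq) (auto simp: mult_ac)
    then have "(c + 1) * L \<le> real n / real (l n)" using elim(5) by (simp add: field_simps)
    \<comment> \<open>The floor in \<open>d\<close> loses less than one, hence less than
      \<open>L\<close>; this is why \<open>t\<close> was chosen with \<open>c + 1\<close>.\<close>
    moreover have "real n / real (l n) < real d + 1"
    proof -
      have "n < n div l n * l n + l n"
        using div_mult_mod_eq[of n "l n"] mod_less_divisor[OF elim(5), of n] by linarith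
      then have "real n < (real d + 1) * real (l n)"
        unfolding d_def by (simp add: distrib_right flip: of_nat_mult of_nat_add)
      then show ?thesis using elim(5) by (simp add: pos_divide_less_eq)
    qed
    ultimately have dL: "c * L < real d" using L by (simp add: algebra_simps)
    then have d: "d > 0" using c L by (smt (verit) mult_pos_pos of_nat_0_less_iff)
    have "0 \<le> (1 - 3 * \<kappa>) * E / N0" using \<kappa> E assms(1) by simp
    then have one: "1 \<le> exp ((1 - 3 * \<kappa>) * E / N0)" by simp
    then have M1: "1 \<le> M" unfolding M_def by (simp add: le_nat_iff le_floor_iff)
    have Mle: "real M \<le> exp ((1 - 3 * \<kappa>) * E / N0)" unfolding M_def by simp
    \<comment> \<open>Rounding \<open>M\<close> down costs at most a factor two, later absorbed
      because \<open>\<kappa> * E / N0\<close> exceeds \<open>ln 2\<close>.\<close>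
    have Mge: "exp ((1 - 3 * \<kappa>) * E / N0) \<le> 2 * real M"
    proof -
      have "exp ((1 - 3 * \<kappa>) * E / N0) < real M + 1" unfolding M_def by linarith
      then show ?thesis using M1 by linarith
    qed
    have "real M \<le> exp (\<kappa>^2 * d / 16)"
    proof (rule order_trans[OF Mle], simp only: exp_le_cancel_iff)
      have "(1 - 3 * \<kappa>) * E / N0 \<le> 1 * E / N0"
        using \<kappa> E assms(1) by (intro divide_right_mono mult_right_mono) auto
      also have "1 * E / N0 = \<kappa>^2 / 16 * (c * L)" using \<kappa> assms(1) by (simp add: c_def E_def)
      also have "\<dots> \<le> \<kappa>^2 / 16 * d" using dL by (intro mult_left_mono) auto
      finally show "(1 - 3 * \<kappa>) * E / N0 \<le> \<kappa>^2 * d / 16" by simp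
    qed
    moreover have "l n * (exp (- (\<kappa>^2 * E / (4 * N0))) + M * exp (- ((1 - 2 * \<kappa>) * E / N0))) \<le> \<epsilon>"
    proof -
      have 1: "exp (- (\<kappa>^2 * E / (4 * N0))) = 1 / real n ^ 2"
      proof -
        have "\<kappa>^2 * E / (4 * N0) = real 2 * L" using \<kappa> assms(1) by (simp add: E_def K_def)
        then show ?thesis using n by (simp add: exp_minus exp_double L_def inverse_eq_divide)
      qed
      have "M * exp (- ((1 - 2 * \<kappa>) * E / N0)) \<le> exp ((1 - 3 * \<kappa>) * E / N0) * exp (- ((1 - 2 * \<kappa>) * E / N0))"
        using Mle by (intro mult_right_mono) auto
      also have "\<dots> = exp (- (\<kappa> * E / N0))"
        by (simp add: exp_add[symmetric] algebra_simps add_divide_distrib[symmetric] diff_divide_distrib[symmetric])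
      also have "\<dots> \<le> exp (- (\<kappa>^2 * E / (4 * N0)))"
      proof -
        have "\<kappa>^2 / 4 \<le> \<kappa>" using \<kappa> by (simp add: power2_eq_square)
        then have "\<kappa>^2 / 4 * (E / N0) \<le> \<kappa> * (E / N0)" using E assms(1) by (intro mult_right_mono) auto
        then show ?thesis by simp
      qed
      finally have 2: "M * exp (- ((1 - 2 * \<kappa>) * E / N0)) \<le> 1 / real n ^ 2" unfolding 1 .
      \<comment> \<open>Each user owns at least one channel use, since \<open>d > 0\<close>.\<close>
      have "real (l n) \<le> real n"
        using d by (metis d_def div_less gr_implies_not0 not_le_imp_less of_nat_mono)
      then have "l n * (exp (- (\<kappa>^2 * E / (4 * N0))) + M * exp (- ((1 - 2 * \<kappa>) * E / N0)))
          \<le> real n * (1 / real n ^ 2 + 1 / real n ^ 2)"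
        using 1 2 by (intro mult_mono add_mono) auto
      also have "\<dots> = 2 / real n" using n by (simp add: power2_eq_square)
      finally show ?thesis using elim(3) by simp
    qed
    ultimately obtain f g where fg: "is_code N0 n (l n) (\<alpha> n) M E \<epsilon> f g" "orthogonal_access n (l n) M f"
      using exists_orthogonal_code[of N0 E \<kappa> "\<alpha> n" M d "l n" n \<epsilon>] assms(1) E \<kappa> \<alpha>[of n] M1 d \<epsilon>
      by (auto simp: d_def)
    have "(1 - 3 * \<kappa>) * E / N0 - ln 2 \<le> ln M"
    proof -
      have "ln (exp ((1 - 3 * \<kappa>) * E / N0)) \<le> ln (2 * real M)"
        using Mge M1 by (subst ln_le_cancel_iff) auto
      then show ?thesis using M1 by (simp add: ln_mult)
    qed
    moreover have "ln 2 < \<kappa> * E / N0"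
    proof -
      have "ln 2 < L * (\<kappa> * K / N0)"
        using elim(2) \<kappa> K assms(1) unfolding L_def by (subst (asm) pos_divide_less_eq) auto
      then show ?thesis by (simp add: E_def mult_ac)
    qed
    moreover have "(1 - 4 * \<kappa>) / N0 * E = (1 - 3 * \<kappa>) * E / N0 - \<kappa> * E / N0"
      using assms(1) by (simp add: field_simps)
    ultimately have "(1 - 4 * \<kappa>) / N0 * E < ln M" by linarith
    then have "(1 - 4 * \<kappa>) / N0 * E / ln b < ln M / ln b"
      using lb by (rule divide_strict_right_mono)
    then have "(1 - 4 * \<kappa>) / N0 / ln b < log b M / E"
      unfolding pos_less_divide_eq[OF E] by (simp add: log_def)
    moreover have "log b (exp 1) / N0 - \<delta> < (1 - 4 * \<kappa>) / N0 / ln b"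
    proof -
      have "4 * \<kappa> < \<delta> * N0 * ln b" using \<kappa> by linarith
      then have "4 * \<kappa> / (N0 * ln b) < \<delta>" using lb assms(1) by (simp add: field_simps)
      then show ?thesis by (simp add: log_def diff_divide_distrib mult.commute)
    qed
    ultimately show ?case using fg E by (intro exI[of _ M] exI[of _ E] exI[of _ f] exI[of _ g]) auto
  qed
  then show "\<exists>n0. \<forall>n\<ge>n0. \<exists>M E f g.
        is_code N0 n (l n) (\<alpha> n) M E \<epsilon> f g \<and> orthogonal_access n (l n) M f \<and>
        0 < E \<and> log b (real M) / E > log b (exp 1) / N0 - \<delta>"
    unfolding eventually_sequentially .
qed

theorem theorem2:
  fixes N0 b a :: real and l :: "nat \<Rightarrow> nat" and \<alpha> :: "nat \<Rightarrow> real"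
  assumes "N0 > 0" and "b > 1"
    and "\<And>n. 0 \<le> \<alpha> n \<and> \<alpha> n \<le> 1"
    and "a \<in> {0..1}" and "\<alpha> \<longlonglongrightarrow> a"
    and "(\<lambda>n. \<alpha> n * real (l n)) \<in> \<Omega>(\<lambda>_. 1)"
  shows "((\<lambda>n. real (l n)) \<in> o(\<lambda>n. real n / log b (real n)) \<longrightarrow>
            C_orth b N0 l \<alpha> = ennreal (log b (exp 1) / N0)) \<and>
         ((\<lambda>n. real (l n)) \<in> \<omega>(\<lambda>n. real n / log b (real n)) \<longrightarrow>
            C_orth b N0 l \<alpha> = 0)"
proof (intro conjI impI)
  obtain c where c: "c > 0" and "eventually (\<lambda>n. norm (\<alpha> n * real (l n)) \<ge> c * norm (1::real)) sequentially"
    using assms(6) by (elim landau_omega.bigE)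
  then have ev: "eventually (\<lambda>n. c \<le> \<alpha> n * real (l n)) sequentially"
    using assms(3) by (simp add: abs_mult)
  {
    assume l: "(\<lambda>n. real (l n)) \<in> o(\<lambda>n. real n / log b (real n))"
    \<comment> \<open>An average number of active users bounded away from zero rules out
      \<open>l n = 0\<close>.\<close>
    have "eventually (\<lambda>n. 0 < l n) sequentially"
      using ev by eventually_elim (use c in \<open>auto intro: gr0I\<close>)
    then have "achievable_orth b N0 l \<alpha> (log b (exp 1) / N0)"
      by (intro capacity_achievable assms l)
    moreover have "0 \<le> log b (exp 1) / N0" using assms(1,2) by (simp add: log_def)
    ultimately show "C_orth b N0 l \<alpha> = ennreal (log b (exp 1) / N0)"
      unfolding C_orth_def
    proof (intro antisym Sup_least Sup_upper)
      fix x assume "x \<in> {ennreal R | R. 0 \<le> R \<and> achievable_orth b N0 l \<alpha> R}"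
      then obtain R where R: "x = ennreal R" "achievable_orth b N0 l \<alpha> R" by blast
      show "x \<le> ennreal (log b (exp 1) / N0)"
        unfolding R(1) by (intro ennreal_leI achievable_le_capacity[OF assms(1-3) c ev R(2)])
    qed blast
  }
  assume l: "(\<lambda>n. real (l n)) \<in> \<omega>(\<lambda>n. real n / log b (real n))"
  have "R = 0" if "0 \<le> R" "achievable_orth b N0 l \<alpha> R" for R
    using no_positive_rate[OF assms(1-3) c ev l that(2)] that(1) by simp
  \<comment> \<open>This covers an empty set of achievable rates too, whose supremum in
    \<open>ennreal\<close> is zero.\<close>
  then have "x \<le> 0" if "x \<in> {ennreal R | R. 0 \<le> R \<and> achievable_orth b N0 l \<alpha> R}" for x
    using that by auto
  then show "C_orth b N0 l \<alpha> = 0"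
    unfolding C_orth_def using Sup_least[of "{ennreal R | R. 0 \<le> R \<and> achievable_orth b N0 l \<alpha> R}" 0] by simp
qed

end
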